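(* Let $n = p_1^{m_1} \cdots p_r^{m_r}$, where $p_1,\ldots,p_r$ are distinct primes and $m_1,\ldots,m_r$ are positive integers. Then the cyclotomic matroid $\mu_n$ is dual (orthogonal) to the direct sum of $p_1^{m_1-1} \cdots p_r^{m_r-1}$ copies of the simplicial matroid $\mathcal{S}(\Delta^{r-1}_{p_1,\ldots,p_r},\mathbb{Q})$.
   Context: Let $\zeta$ be a primitive $n$-th root of unity. The cyclotomic matroid $\mu_n$ is the matroid on the $n$-element ground set $Z_n=\{1,\zeta,\zeta^2,\ldots,\zeta^{n-1}\}$ represented over $\mathbb{Q}$ by these elements viewed as vectors in the $\mathbb{Q}$-vector space $\mathbb{Q}(\zeta)$ (so a subset is independent iff it is $\mathbb{Q}$-linearly independent); it has rank $\phi(n)$. For positive integers $n_1,\dots,n_r$, let $\Delta^0_{n_i}$ be the $0$-dimensional complex consisting of $n_i$ disjoint vertices, and let $\Delta^{r-1}_{n_1,\ldots,n_r}=\Delta^0_{n_1}*\cdots*\Delta^0_{n_r}$ be their simplicial join: its faces are the vertex sets containing at most one vertex from each $\Delta^0_{n_i}$, so its facets are the $(r-1)$-simplices with exactly one vertex from each $\Delta^0_{n_i}$. For a $d$-dimensional simplicial complex $\Delta$, the simplicial matroid $\mathcal{S}(\Delta,\mathbb{Q})$ is the matroid on the set of $d$-dimensional faces (facets) of $\Delta$ represented over $\mathbb{Q}$ by the columns of the matrix of the boundary map $\partial_d:\tilde C_d(\Delta,\mathbb{Q})\to\tilde C_{d-1}(\Delta,\mathbb{Q})$ of the augmented (reduced)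 simplicial chain complex (for $d=0$, $\tilde C_{-1}=\mathbb{Q}$ and $\partial_0$ is the augmentation). The dual of a matroid $M$ on $E$ is the matroid on $E$ whose bases are the complements of the bases of $M$; "dual" here means isomorphic to the dual under some bijection of ground sets. *)

theory Defs
  imports
    "HOL-Computational_Algebra.Primes"
    "HOL-Library.Poly_Mapping"
    Complex_Main
begin

section \<open>Matroids\<close>

text \<open>
  A matroid is given by its ground set and its family of independent sets; \<open>is_matroid\<close> states
  the axioms.
\<close>

record 'a matroid =
  ground :: "'a set"
  indeps :: "'a set set"

definition is_matroid :: "'a matroid \<Rightarrow> bool" where
  "is_matroid M \<longleftrightarrow>
     finite (ground M) \<and>
     indeps M \<subseteq> Pow (ground M) \<and>
     {} \<in> indeps M \<and>
     (\<forall>I J. J \<in> indeps M \<and> I \<subseteq> J \<longrightarrow> I \<in> indeps M) \<and>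
     (\<forall>I J. I \<in> indeps M \<and> J \<in> indeps M \<and> card I < card J \<longrightarrow>
        (\<exists>e \<in> J - I. insert e I \<in> indeps M))"

definition bases :: "'a matroid \<Rightarrow> 'a set set" where
  "bases M = {B \<in> indeps M. \<forall>I \<in> indeps M. B \<subseteq> I \<longrightarrow> I = B}"

text \<open>The independent sets of the dual are the subsets of the complements of the bases.\<close>

definition dual_matroid :: "'a matroid \<Rightarrow> 'a matroid" where
  "dual_matroid M =
     \<lparr>ground = ground M, indeps = {I. \<exists>B \<in> bases M. I \<subseteq> ground M - B}\<rparr>"

definition direct_sum_matroid :: "'i set \<Rightarrow> ('i \<Rightarrow> 'a matroid) \<Rightarrow> ('i \<times> 'a) matroid" where
  "direct_sum_matroid K M =
     \<lparr>ground = (SIGMA k:K. ground (M k)),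
      indeps = {I. I \<subseteq> (SIGMA k:K. ground (M k)) \<and> (\<forall>k\<in>K. {e. (k, e) \<in> I} \<in> indeps (M k))}\<rparr>"

definition matroid_iso :: "'a matroid \<Rightarrow> 'b matroid \<Rightarrow> bool" where
  "matroid_iso M N \<longleftrightarrow>
     (\<exists>f. bij_betw f (ground M) (ground N) \<and>
          (\<forall>I \<subseteq> ground M. I \<in> indeps M \<longleftrightarrow> f ` I \<in> indeps N))"

text \<open>
  The matroid represented by a family of vectors. Independence is that of the family
  \<open>(v e)\<^sub>e\<close>, so repeated vectors are dependent; this is why injectivity is required in addition to
  independence of the set of vectors.
\<close>

definition represented_matroid ::
    "('k::field \<Rightarrow> 'v::ab_group_add \<Rightarrow> 'v) \<Rightarrow> 'e set \<Rightarrow> ('e \<Rightarrow> 'v) \<Rightarrow> 'e matroid" where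
  "represented_matroid scale E v =
     \<lparr>ground = E,
      indeps = {I. I \<subseteq> E \<and> inj_on v I \<and> \<not> module.dependent scale (v ` I)}\<rparr>"

lemma is_matroid_represented_matroid:
  assumes "vector_space scale" and "finite E"
  shows "is_matroid (represented_matroid scale E v)"
proof -
  interpret vector_space scale by fact
  have aug: "\<exists>e\<in>J - I. inj_on v (insert e I) \<and> independent (v ` insert e I)"
    if I: "I \<subseteq> E" "inj_on v I" "independent (v ` I)"
      and J: "J \<subseteq> E" "inj_on v J" "independent (v ` J)" and less: "card I < card J" for I J
  proof (rule ccontr)
    assume *: "\<not> ?thesis"
    have "v e \<in> span (v ` I)" if "e \<in> J" for e
    proof (cases "e \<in> I")
      case True
      then show ?thesis by (simp add: span_base)
    next
      case False
      show ?thesis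
      proof (rule ccontr)
        assume n: "v e \<notin> span (v ` I)"
        then have "v e \<notin> v ` I" using span_base by blast
        with n I have "inj_on v (insert e I) \<and> independent (v ` insert e I)"
          by (auto simp: independent_insert)
        with * False that show False by blast
      qed
    qed
    then have "card (v ` J) \<le> card (v ` I)"
      using independent_span_bound[of "v ` I" "v ` J"] I J \<open>finite E\<close>
      by (meson finite_imageI finite_subset image_subsetI)
    with less I J show False by (simp add: card_image)
  qed
  have empty: "independent {}"
    by (rule independent_empty)
  have sub: "independent (v ` I)" if "independent (v ` J)" "I \<subseteq> J" for I J
    using that by (meson image_mono independent_mono)
  have aug': "\<exists>e\<in>J - I. insert e I \<subseteq> E \<and> inj_on v (insert e I) \<and> independent (v ` insert e I)"
    if "I \<subseteq> E" "inj_on v I" "independent (v ` I)"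
      "J \<subseteq> E" "inj_on v J" "independent (v ` J)" "card I < card J" for I J
    using aug[OF that] that(1,4) by blast
  show ?thesis
    unfolding is_matroid_def represented_matroid_def matroid.simps mem_Collect_eq
  proof (intro conjI allI impI)
    fix I J
    assume "(I \<subseteq> E \<and> inj_on v I \<and> independent (v ` I)) \<and>
      (J \<subseteq> E \<and> inj_on v J \<and> independent (v ` J)) \<and> card I < card J"
    then show "\<exists>e\<in>J - I. insert e I \<subseteq> E \<and> inj_on v (insert e I) \<and> independent (v ` insert e I)"
      by (intro aug') simp_all
  qed (use \<open>finite E\<close> empty sub in \<open>auto intro: inj_on_subset\<close>)
qed


section \<open>Cyclotomic matroids\<close>

definition primitive_root_of_unity :: "nat \<Rightarrow> complex \<Rightarrow> bool" where
  "primitive_root_of_unity n z \<longleftrightarrow> n > 0 \<and> z ^ n = 1 \<and> (\<forall>k. 0 < k \<and> k < n \<longrightarrow> z ^ k \<noteq> 1)"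

definition rat_scale :: "rat \<Rightarrow> complex \<Rightarrow> complex" where
  "rat_scale q z = of_rat q * z"

lemma vector_space_rat_scale: "vector_space rat_scale"
  by unfold_locales (simp_all add: rat_scale_def of_rat_add of_rat_mult algebra_simps)

text \<open>
  Linear independence over the rationals does not depend on the ambient rational vector space,
  so we work in the complex numbers instead of the subspace \<open>\<rat>(\<zeta>)\<close>.
\<close>

definition cyclotomic_matroid :: "nat \<Rightarrow> complex \<Rightarrow> complex matroid" where
  "cyclotomic_matroid n \<zeta> = represented_matroid rat_scale ((\<lambda>k. \<zeta> ^ k) ` {..<n}) (\<lambda>z. z)"


section \<open>Simplicial matroids\<close>

text \<open>
  A simplicial complex is given by its set of faces, including the empty face. The augmented
  chain complex is graded by the cardinality of faces and treated as one rational vector space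
  with a single boundary map; on vertices this map is the augmentation \<open>{v} \<mapsto> {}\<close>, and it sends
  the empty face to 0.
\<close>

type_synonym 'v chain = "'v set \<Rightarrow>\<^sub>0 rat"

definition chain_scale :: "rat \<Rightarrow> 'v chain \<Rightarrow> 'v chain" where
  "chain_scale q c = Poly_Mapping.map ((*) q) c"

lemma lookup_chain_scale [simp]:
  "Poly_Mapping.lookup (chain_scale q c) F = q * Poly_Mapping.lookup c F"
  by (simp add: chain_scale_def Poly_Mapping.map.rep_eq when_def)

lemma vector_space_chain_scale: "vector_space chain_scale"
  by unfold_locales (simp_all add: poly_mapping_eq_iff fun_eq_iff lookup_add algebra_simps)

text \<open>
  Orientations come from a strict linear order \<open>R\<close> on the vertices: the sign of \<open>F - {v}\<close> is
  determined by the number of vertices of \<open>F\<close> preceding \<open>v\<close>.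
\<close>

definition boundary :: "'v rel \<Rightarrow> 'v chain \<Rightarrow> 'v chain" where
  "boundary R c =
     (\<Sum>F\<in>Poly_Mapping.keys c. chain_scale (Poly_Mapping.lookup c F)
        (\<Sum>v\<in>F. Poly_Mapping.single (F - {v}) ((- 1) ^ card {w \<in> F. (w, v) \<in> R})))"

lemma boundary_single:
  "boundary R (Poly_Mapping.single F 1) =
     (\<Sum>v\<in>F. Poly_Mapping.single (F - {v}) ((- 1) ^ card {w \<in> F. (w, v) \<in> R}))"
proof -
  interpret vector_space chain_scale by (rule vector_space_chain_scale)
  show ?thesis by (simp add: boundary_def)
qed

definition top_faces :: "'v set set \<Rightarrow> 'v set set" where
  "top_faces \<Delta> = {F \<in> \<Delta>. card F = Max (card ` \<Delta>)}"

definition simplicial_matroid :: "'v rel \<Rightarrow> 'v set set \<Rightarrow> 'v set matroid" where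
  "simplicial_matroid R \<Delta> =
     represented_matroid chain_scale (top_faces \<Delta>) (\<lambda>F. boundary R (Poly_Mapping.single F 1))"

definition discrete_complex :: "nat \<Rightarrow> nat set set" where
  "discrete_complex k = insert {} ((\<lambda>j. {j}) ` {..<k})"

text \<open>The join lives on the disjoint union of the vertex sets, tagged by the index.\<close>

definition simplicial_join :: "'i set \<Rightarrow> ('i \<Rightarrow> 'v set set) \<Rightarrow> ('i \<times> 'v) set set" where
  "simplicial_join A \<Delta> =
     {F. F \<subseteq> (SIGMA i:A. \<Union>(\<Delta> i)) \<and> (\<forall>i\<in>A. {v. (i, v) \<in> F} \<in> \<Delta> i)}"

definition join_of_points :: "nat \<Rightarrow> (nat \<Rightarrow> nat) \<Rightarrow> (nat \<times> nat) set set" where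
  "join_of_points r k = simplicial_join {..<r} (\<lambda>i. discrete_complex (k i))"

lemma join_of_points_iff:
  "F \<in> join_of_points r k \<longleftrightarrow>
     F \<subseteq> (SIGMA i:{..<r}. {..<k i}) \<and>
     (\<forall>i j j'. (i, j) \<in> F \<and> (i, j') \<in> F \<longrightarrow> j = j')"
proof -
  have union: "\<Union>(discrete_complex c) = {..<c}" for c
    by (auto simp: discrete_complex_def)
  have face: "A \<in> discrete_complex c \<longleftrightarrow> A \<subseteq> {..<c} \<and> (\<forall>a\<in>A. \<forall>b\<in>A. a = b)" for A c
  proof (cases "A = {}")
    case False
    then obtain a where "a \<in> A" by blast
    then have "(\<forall>x\<in>A. \<forall>y\<in>A. x = y) \<longleftrightarrow> A = {a}" by blast
    then show ?thesis
      using False \<open>a \<in> A\<close> by (auto simp: discrete_complex_def)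
  qed (simp add: discrete_complex_def)
  have face_slice: "{j. (i, j) \<in> F} \<in> discrete_complex (k i) \<longleftrightarrow>
      (\<forall>j j'. (i, j) \<in> F \<and> (i, j') \<in> F \<longrightarrow> j = j')"
    if "F \<subseteq> (SIGMA i:{..<r}. {..<k i})" for i
  proof -
    have "{j. (i, j) \<in> F} \<subseteq> {..<k i}"
      using that by blast
    then show ?thesis
      unfolding face mem_Collect_eq by blast
  qed
  show ?thesis
  proof (cases "F \<subseteq> (SIGMA i:{..<r}. {..<k i})")
    case True
    then have "(\<forall>i\<in>{..<r}. \<forall>j j'. (i, j) \<in> F \<and> (i, j') \<in> F \<longrightarrow> j = j') \<longleftrightarrow>
        (\<forall>i j j'. (i, j) \<in> F \<and> (i, j') \<in> F \<longrightarrow> j = j')"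
      by blast
    with True show ?thesis
      unfolding join_of_points_def simplicial_join_def union mem_Collect_eq face_slice[OF True]
      by simp
  next
    case False
    then show ?thesis
      unfolding join_of_points_def simplicial_join_def union mem_Collect_eq by simp
  qed
qed

definition lex_less :: "(nat \<times> nat) rel" where
  "lex_less = less_than <*lex*> less_than"

end

theory Submission
  imports Defs "HOL-Number_Theory.Cong" "Jordan_Normal_Form.Char_Poly"
begin

text \<open>
  The circuits of the dual of a represented matroid are the minimal supports of its row space, so
  the claim says that the rational relations among the \<open>n\<close>-th roots of unity are, copy by copy, the
  coboundaries of the codimension one faces of the join. Such coboundaries are functions constant
  along one coordinate direction of the torus given by the Chinese remainder theorem, and they are
  clearly relations. Conversely, since Galois conjugation preserves rational relations, the
  coefficient function \<open>c\<close> of a relation has a Fourier transform that vanishes at all residues prime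
  to \<open>n\<close>. The product over the primes \<open>p\<close> dividing \<open>n\<close> of the operators \<open>1 - A\<^sub>p\<close>, where \<open>A\<^sub>p\<close>
  averages over the translates by multiples of \<open>n / p\<close>, kills the Fourier transform at all other
  residues. It therefore annihilates \<open>c\<close>, and expanding it writes \<open>c\<close> as a sum of functions that are
  periodic with periods \<open>n / p\<close>.
\<close>

section \<open>Galois conjugation of relations among roots of unity\<close>

lemma root_of_unity_power_mod:
  fixes \<eta> :: "'a::monoid_mult"
  assumes "\<eta> ^ n = 1"
  shows "\<eta> ^ (k mod n) = \<eta> ^ k"
proof -
  have "\<eta> ^ k = \<eta> ^ (n * (k div n) + k mod n)" by simp
  also have "\<dots> = \<eta> ^ (k mod n)" by (simp only: power_add power_mult assms) simp
  finally show ?thesis by simp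
qed

text \<open>
  Multiplication by \<open>f(\<eta>)\<close> maps each power of \<open>\<eta>\<close> to an integer combination of the first \<open>n\<close>
  powers, so \<open>f(\<eta>)\<close> is an eigenvalue of an integer matrix.
\<close>

lemma algebraic_int_poly_root_of_unity:
  fixes \<eta> :: complex and f :: "int poly"
  assumes n: "n > 0" and \<eta>: "\<eta> ^ n = 1"
  shows "algebraic_int (poly (map_poly of_int f) \<eta>)"
proof -
  let ?K = "{..degree f}"
  define A where "A = mat n n (\<lambda>(i, j). \<Sum>k | k \<in> ?K \<and> (i + k) mod n = j. coeff f k)"
  define v where "v = vec n (\<lambda>j. \<eta> ^ j)"
  let ?B = "map_mat of_int A :: complex mat"
  let ?a = "poly (map_poly of_int f) \<eta>"
  have A: "A \<in> carrier_mat n n" by (simp add: A_def)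
  have B: "?B \<in> carrier_mat n n" using A by simp
  have a: "?a = (\<Sum>k\<in>?K. of_int (coeff f k) * \<eta> ^ k)"
    by (simp add: poly_altdef coeff_map_poly degree_map_poly)
  have "?B *\<^sub>v v = ?a \<cdot>\<^sub>v v"
  proof (rule eq_vecI)
    fix i assume "i < dim_vec (?a \<cdot>\<^sub>v v)"
    then have i: "i < n" by (simp add: v_def)
    have "(?B *\<^sub>v v) $ i = (\<Sum>j<n. of_int (A $$ (i, j)) * \<eta> ^ j)"
      using i A by (auto simp: v_def scalar_prod_def lessThan_atLeast0 intro!: sum.cong)
    also have "\<dots> = (\<Sum>j<n. \<Sum>k | k \<in> ?K \<and> (i + k) mod n = j. of_int (coeff f k) * \<eta> ^ j)"
      using i by (intro sum.cong) (auto simp: A_def sum_distrib_right)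
    also have "\<dots> = (\<Sum>j<n. \<Sum>k | k \<in> ?K \<and> (i + k) mod n = j.
        of_int (coeff f k) * \<eta> ^ ((i + k) mod n))"
      by (intro sum.cong) auto
    also have "\<dots> = (\<Sum>k\<in>?K. of_int (coeff f k) * \<eta> ^ ((i + k) mod n))"
      using n by (intro sum.group) auto
    also have "\<dots> = (?a \<cdot>\<^sub>v v) $ i"
      using i by (simp add: root_of_unity_power_mod[OF \<eta>] a v_def power_add
          sum_distrib_left mult_ac)
    finally show "(?B *\<^sub>v v) $ i = (?a \<cdot>\<^sub>v v) $ i" .
  qed (use A in \<open>simp add: v_def\<close>)
  moreover have "v $ 0 \<noteq> 0\<^sub>v n $ 0" using n by (simp add: v_def)
  ultimately have "eigenvalue ?B ?a"
    unfolding eigenvalue_def eigenvector_def using A by (auto intro!: exI[of _ v] simp: v_def)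
  then have "poly (char_poly ?B) ?a = 0"
    using eigenvalue_root_char_poly[OF B] by simp
  then have "poly (map_poly of_int (char_poly A)) ?a = 0"
    using of_int_hom.char_poly_hom[OF A] by metis
  with degree_monic_char_poly[OF A] show ?thesis
    unfolding algebraic_int_altdef_ipoly by (intro exI[of _ "char_poly A"]) simp
qed

text \<open>Stripping factors of the variable from \<open>P\<close> leaves a nonzero constant term
  and a polynomial that still kills the nonzero \<alpha>; moving that term across the equation gives
  \<open>D\<close>. This takes the place of the norm of \<alpha>.\<close>

lemma integer_multiple_of_algebraic:
  fixes \<alpha> :: "'a::field_char_0" and P :: "int poly"
  assumes "P \<noteq> 0" and "poly (map_poly of_int P) \<alpha> = 0" and "\<alpha> \<noteq> 0"
  shows "\<exists>D Q. D \<noteq> 0 \<and> \<alpha> * poly (map_poly of_int Q) \<alpha> = of_int D"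
  using assms(1,2)
proof (induction P rule: pCons_induct)
  case (pCons a P)
  show ?case
  proof (cases "a = 0")
    case True
    with pCons assms(3) show ?thesis by (auto simp: map_poly_pCons)
  next
    case False
    with pCons(4) show ?thesis
      by (intro exI[of _ "- a"] exI[of _ P]) (simp add: map_poly_pCons add_eq_0_iff2)
  qed
qed simp

section \<open>Frobenius congruences modulo a prime\<close>

text \<open>The inner binomial coefficients are divisible by \<open>p\<close>. A general commutative
  ring covers both integers and integer polynomials.\<close>

lemma prime_dvd_power_add_diff:
  fixes a b :: "'a::comm_ring_1"
  assumes "prime (p :: nat)"
  shows "of_nat p dvd (a + b) ^ p - (a ^ p + b ^ p)"
proof -
  have p: "p > 0" using assms prime_gt_0_nat by blast
  have "(a + b) ^ p = (\<Sum>k\<le>p. of_nat (p choose k) * a ^ k * b ^ (p - k))"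
    by (rule binomial_ring)
  also have "{..p} = insert 0 (insert p {1..<p})"
    using p by auto
  also have "(\<Sum>k\<in>\<dots>. of_nat (p choose k) * a ^ k * b ^ (p - k)) =
      a ^ p + b ^ p + (\<Sum>k\<in>{1..<p}. of_nat (p choose k) * a ^ k * b ^ (p - k))"
    using p by simp
  finally have "(a + b) ^ p - (a ^ p + b ^ p) =
      (\<Sum>k\<in>{1..<p}. of_nat (p choose k) * a ^ k * b ^ (p - k))" by simp
  moreover have "of_nat p dvd (of_nat (p choose k) * a ^ k * b ^ (p - k) :: 'a)"
    if "k \<in> {1..<p}" for k
  proof -
    have "p dvd p choose k" using that assms by (intro dvd_choose_prime) auto
    then obtain c where "p choose k = p * c" by (elim dvdE)
    then show ?thesis by simp
  qed
  ultimately show ?thesis by (metis (no_types, lifting) dvd_sum)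
qed

text \<open>Fermat's little theorem: induction with the previous congruence settles natural numbers,
  reduction modulo \<open>p\<close> all integers.\<close>

lemma prime_dvd_power_diff_self:
  fixes a :: int
  assumes "prime (p :: nat)"
  shows "int p dvd a ^ p - a"
proof -
  have p: "p > 0" using assms prime_gt_0_nat by blast
  have nat: "int p dvd int k ^ p - int k" for k
  proof (induction k)
    case 0
    then show ?case using p by (simp add: zero_power)
  next
    case (Suc k)
    have "int p dvd ((int k + 1) ^ p - (int k ^ p + 1 ^ p)) + (int k ^ p - int k)"
      using prime_dvd_power_add_diff[OF assms, of "int k" 1] Suc by (intro dvd_add) simp_all
    then show ?case by (simp add: algebra_simps)
  qed
  define k where "k = nat (a mod int p)"
  have k: "[a = int k] (mod int p)" using p by (simp add: k_def cong_def)
  have "[a ^ p - a = int k ^ p - int k] (mod int p)"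
    by (intro cong_diff cong_pow k)
  with nat[of k] show ?thesis using cong_dvd_iff by blast
qed

text \<open>Modulo \<open>p\<close> the Frobenius map is additive and, by Fermat, fixes constants,
  so induction over the coefficients moves the power into the variable.\<close>

lemma prime_dvd_poly_frobenius:
  fixes f :: "int poly"
  assumes "prime (p :: nat)"
  shows "of_nat p dvd f ^ p - pcompose f (monom 1 p)"
proof (induction f rule: pCons_induct)
  case 0
  show ?case using assms prime_gt_0_nat by (simp add: zero_power)
next
  case (pCons a f)
  let ?X = "monom 1 (Suc 0) :: int poly"
  have eq: "pCons a f = [:a:] + ?X * f" by (simp add: monom_altdef)
  have Xp: "?X ^ p = monom 1 p" by (simp add: monom_power)
  have "of_nat p dvd pCons a f ^ p - ([:a:] ^ p + (?X * f) ^ p)"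
    unfolding eq by (rule prime_dvd_power_add_diff[OF assms])
  moreover have "of_nat p dvd [:a:] ^ p - [:a:]"
  proof -
    obtain c where "a ^ p - a = int p * c"
      using prime_dvd_power_diff_self[OF assms, of a] by (elim dvdE)
    then have "[:a:] ^ p - [:a:] = of_nat p * [:c:]"
      by (simp add: poly_const_pow of_nat_poly)
    then show ?thesis by (rule dvdI)
  qed
  moreover have "of_nat p dvd monom 1 p * (f ^ p - pcompose f (monom 1 p))"
    using pCons.IH by simp
  ultimately have "of_nat p dvd (pCons a f ^ p - ([:a:] ^ p + (?X * f) ^ p)) + ([:a:] ^ p - [:a:])
      + monom 1 p * (f ^ p - pcompose f (monom 1 p))"
    by (intro dvd_add)
  also have "\<dots> = pCons a f ^ p - pcompose (pCons a f) (monom 1 p)"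
    by (simp add: pcompose_pCons power_mult_distrib Xp algebra_simps)
  finally show ?case .
qed

text \<open>
  If \<open>f(\<eta>\<^sup>p) \<noteq> 0\<close>, then \<open>f(\<eta>\<^sup>p)\<close> divides a nonzero integer that does not depend on \<open>p\<close>, while
  \<open>f(\<eta>) = 0\<close> makes it divisible by \<open>p\<close>; this is impossible for large \<open>p\<close>.
\<close>

lemma root_of_unity_conjugate_large_prime:
  fixes f :: "int poly"
  assumes n: "n > 0"
  obtains B :: nat where
    "\<And>p \<eta>. \<lbrakk>prime p; p > B; \<eta> ^ n = 1; poly (map_poly of_int f) (\<eta> :: complex) = 0\<rbrakk>
      \<Longrightarrow> poly (map_poly of_int f) (\<eta> ^ p) = 0"
proof -
  let ?f = "\<lambda>\<eta> :: complex. poly (map_poly of_int f) \<eta>"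
  let ?Z = "{\<eta> :: complex. \<eta> ^ n = 1}"
  have "\<exists>D g. D \<noteq> 0 \<and> ?f \<eta> * poly (map_poly of_int g) \<eta> = of_int D"
    if \<eta>: "\<eta> \<in> ?Z" and nz: "?f \<eta> \<noteq> 0" for \<eta>
  proof -
    obtain P where "poly (map_poly of_int P) (?f \<eta>) = 0" "lead_coeff P = 1"
      using algebraic_int_poly_root_of_unity[OF n, of \<eta> f] \<eta>
      unfolding algebraic_int_altdef_ipoly by auto
    then obtain D Q where "D \<noteq> 0" "?f \<eta> * poly (map_poly of_int Q) (?f \<eta>) = of_int D"
      using integer_multiple_of_algebraic[of P "?f \<eta>"] nz by force
    \<comment> \<open>The cofactor is a polynomial in f(\<eta>); composing with \<open>f\<close>
      makes it an integer polynomial in the root of unity itself.\<close>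
    moreover have "poly (map_poly of_int (pcompose Q f)) \<eta> = poly (map_poly of_int Q) (?f \<eta>)"
      by (simp add: of_int_hom.map_poly_pcompose poly_pcompose)
    ultimately show ?thesis by metis
  qed
  then obtain D g where D: "\<And>\<eta>. \<lbrakk>\<eta> \<in> ?Z; ?f \<eta> \<noteq> 0\<rbrakk> \<Longrightarrow> D \<eta> \<noteq> (0::int)"
    and g: "\<And>\<eta>. \<lbrakk>\<eta> \<in> ?Z; ?f \<eta> \<noteq> 0\<rbrakk> \<Longrightarrow> ?f \<eta> * poly (map_poly of_int (g \<eta>)) \<eta> = of_int (D \<eta>)"
    by metis
  have fin: "finite ?Z" using n by (intro finite_roots_unity) auto
  \<comment> \<open>A sum over the finitely many \<open>n\<close>-th roots of unity dominates each
    term, hence is a bound independent of the root.\<close>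
  define B where "B = (\<Sum>\<eta>\<in>?Z. nat \<bar>D \<eta>\<bar>)"
  have DB: "nat \<bar>D \<eta>\<bar> \<le> B" if "\<eta> \<in> ?Z" for \<eta>
    unfolding B_def using that fin by (intro member_le_sum) auto
  show thesis
  proof (rule that[of B], rule ccontr)
    fix p and \<eta> :: complex
    assume p: "prime p" "p > B" and \<eta>: "\<eta> ^ n = 1" and f0: "?f \<eta> = 0" and nz: "?f (\<eta> ^ p) \<noteq> 0"
    have \<eta>p: "\<eta> ^ p \<in> ?Z" using \<eta> by (simp flip: power_mult add: mult.commute[of p n] power_mult)
    obtain h where h: "f ^ p - pcompose f (monom 1 p) = of_nat p * h"
      using prime_dvd_poly_frobenius[OF p(1), of f] by (elim dvdE)
    \<comment> \<open>At \<eta> the power \<open>f ^ p\<close> vanishes, which leaves only the value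
      of \<open>f\<close> at \<open>\<eta> ^ p\<close>.\<close>
    have "poly (map_poly of_int (f ^ p - pcompose f (monom 1 p))) \<eta> =
        poly (map_poly of_int (of_nat p * h)) \<eta>"
      by (simp only: h)
    then have "- ?f (\<eta> ^ p) = of_nat p * poly (map_poly of_int h) \<eta>"
      using f0 prime_gt_0_nat[OF p(1)]
      by (simp add: of_int_hom.map_poly_pcompose poly_pcompose hom_distribs poly_monom
          zero_power)
    then have fp: "?f (\<eta> ^ p) = - of_nat p * poly (map_poly of_int h) \<eta>"
      by (metis minus_minus mult_minus_left)
    \<comment> \<open>Substituting \<open>monom 1 p\<close> turns the value of
      \<open>g (\<eta> ^ p)\<close> at \<open>\<eta> ^ p\<close> into a value at \<eta>, so the
      quotient of \<open>D (\<eta> ^ p)\<close> by \<open>p\<close> is an integer polynomial in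
      \<eta>.\<close>
    let ?G = "- (h * pcompose (g (\<eta> ^ p)) (monom 1 p))"
    have "of_int (D (\<eta> ^ p)) = of_nat p * poly (map_poly of_int ?G) \<eta>"
      using g[OF \<eta>p nz] fp
      by (simp add: mult.assoc of_int_hom.map_poly_pcompose poly_pcompose hom_distribs poly_monom)
    then have "poly (map_poly of_int ?G) \<eta> = of_int (D (\<eta> ^ p)) / of_nat p"
      using prime_gt_0_nat[OF p(1)] by (simp add: field_simps)
    moreover have "algebraic_int (poly (map_poly of_int ?G) \<eta>)"
      by (rule algebraic_int_poly_root_of_unity[OF n \<eta>])
    \<comment> \<open>The quotient is rational and an algebraic integer, hence an integer.\<close>
    ultimately have "(of_int (D (\<eta> ^ p)) / of_nat p :: complex) \<in> \<int>"
      by (metis Rats_divide Rats_of_int Rats_of_nat rational_algebraic_int_is_int)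
    then obtain c where "(of_int (D (\<eta> ^ p)) / of_nat p :: complex) = of_int c"
      by (elim Ints_cases)
    then have "(of_int (D (\<eta> ^ p)) :: complex) = of_int (int p * c)"
      using prime_gt_0_nat[OF p(1)] by (simp add: field_simps)
    then have "int p dvd D (\<eta> ^ p)"
      by (metis dvd_triv_left of_int_eq_iff)
    then have "int p \<le> \<bar>D (\<eta> ^ p)\<bar>"
      using dvd_imp_le_int[OF D[OF \<eta>p nz], of "int p"] by simp
    with DB[OF \<eta>p] p(2) show False by linarith
  qed
qed

section \<open>From large primes to all exponents prime to the order\<close>

text \<open>An elementary substitute for a large prime in the residue class of \<open>a\<close>: add
  to \<open>a\<close> the number \<open>n\<close> times the product of the primes up to
  \<open>B\<close> that do not divide \<open>a\<close>. Every prime up to \<open>B\<close> then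
  divides exactly one of the two summands.\<close>

lemma coprime_cong_large_prime_factors:
  fixes a n B :: nat
  assumes "coprime a n" and "n > 0"
  obtains b where "[b = a] (mod n)" and "b > 0" and "\<And>q. \<lbrakk>prime q; q dvd b\<rbrakk> \<Longrightarrow> q > B"
proof -
  let ?Q = "{q. prime q \<and> q \<le> B \<and> \<not> q dvd a}"
  define b where "b = a + n * \<Prod>?Q"
  have fin: "finite ?Q" by (rule finite_subset[of _ "{..B}"]) auto
  then have pos: "\<Prod>?Q > 0" by (intro prod_pos) (auto simp: prime_gt_0_nat)
  show thesis
  proof (rule that[of b])
    show "[b = a] (mod n)" by (simp add: b_def cong_def)
    show "b > 0" using pos assms by (simp add: b_def)
    fix q assume q: "prime q" "q dvd b"
    show "q > B"
    proof (rule ccontr)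
      assume le: "\<not> q > B"
      show False
      proof (cases "q dvd a")
        case True
        then have "q dvd n * \<Prod>?Q" using q by (simp add: b_def dvd_add_right_iff)
        moreover have "\<not> q dvd n"
          using True assms(1) q(1) not_prime_unit by (metis coprime_common_divisor)
        ultimately have "q dvd \<Prod>?Q" using q(1) prime_dvd_mult_iff by blast
        then obtain q' where "q' \<in> ?Q" "q dvd q'"
          using q(1) fin by (auto simp: prime_dvd_prod_iff)
        with q(1) True show False by (auto dest: primes_dvd_imp_eq)
      next
        case False
        then have "q dvd \<Prod>?Q" using q le fin by (intro dvd_prodI) auto
        then have "q dvd a" using q by (simp add: b_def dvd_add_left_iff)
        with False show False ..
      qed
    qed
  qed
qed

text \<open>A congruent exponent \<open>b\<close> with only large prime factors gives the same power
  of \<zeta>, and it is reached by raising to one large prime at a time.\<close>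

lemma int_poly_root_of_unity_conjugate:
  fixes f :: "int poly" and \<zeta> :: complex
  assumes n: "n > 0" and \<zeta>: "\<zeta> ^ n = 1" and f0: "poly (map_poly of_int f) \<zeta> = 0"
    and a: "coprime a n"
  shows "poly (map_poly of_int f) (\<zeta> ^ a) = 0"
proof -
  obtain B where B: "\<And>p \<eta>. \<lbrakk>prime p; p > B; \<eta> ^ n = 1; poly (map_poly of_int f) (\<eta> :: complex) = 0\<rbrakk>
      \<Longrightarrow> poly (map_poly of_int f) (\<eta> ^ p) = 0"
    using root_of_unity_conjugate_large_prime[OF n, of f] by blast
  obtain b where b: "[b = a] (mod n)" "b > 0" "\<And>q. \<lbrakk>prime q; q dvd b\<rbrakk> \<Longrightarrow> q > B"
    using coprime_cong_large_prime_factors[OF a n, of B] by blast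
  \<comment> \<open>The first conjunct is carried along because each large-prime step must start
    from an \<open>n\<close>-th root of unity.\<close>
  have "(\<zeta> ^ b) ^ n = 1 \<and> poly (map_poly of_int f) (\<zeta> ^ b) = 0"
    using b(2,3)
  proof (induction b rule: prime_divisors_induct)
    case (unit x)
    then show ?case using \<zeta> f0 by simp
  next
    case (factor p x)
    then have IH: "(\<zeta> ^ x) ^ n = 1" "poly (map_poly of_int f) (\<zeta> ^ x) = 0" by auto
    have "poly (map_poly of_int f) ((\<zeta> ^ x) ^ p) = 0"
      using factor by (intro B IH) auto
    moreover have "((\<zeta> ^ x) ^ p) ^ n = 1"
      using IH(1) by (metis mult.commute power_mult power_one)
    ultimately show ?case by (simp add: power_mult mult.commute[of p])
  qed simp
  moreover have "\<zeta> ^ b = \<zeta> ^ a"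
    using b(1) root_of_unity_power_mod[OF \<zeta>] unfolding cong_def by metis
  ultimately show ?thesis by simp
qed

section \<open>From integer to rational coefficients\<close>

lemma common_denominator:
  fixes c :: "'a \<Rightarrow> rat"
  assumes "finite A"
  obtains D :: int and d :: "'a \<Rightarrow> int"
    where "D \<noteq> 0" and "\<And>k. k \<in> A \<Longrightarrow> of_int D * c k = of_int (d k)"
proof -
  have "\<exists>D::int. D \<noteq> 0 \<and> (\<forall>k\<in>A. \<exists>d. of_int D * c k = of_int d)"
    using assms
  proof (induction A)
    case (insert x A)
    then obtain D :: int where D: "D \<noteq> 0" "\<forall>k\<in>A. \<exists>d. of_int D * c k = of_int d" by blast
    obtain u v where uv: "c x = of_int u / of_int v" "v > 0"
      by (metis quotient_of_denom_pos quotient_of_div surj_pair)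
    have "\<exists>d. of_int (v * D) * c k = of_int d" if k: "k \<in> insert x A" for k
    proof (cases "k = x")
      case True
      have "of_int (v * D) * c k = of_int (D * u)" using True uv by simp
      then show ?thesis by blast
    next
      case False
      then obtain d where "of_int D * c k = of_int d" using D(2) k by blast
      then have "of_int (v * D) * c k = of_int (v * d)" by (simp add: mult.assoc)
      then show ?thesis by blast
    qed
    then show ?case using D(1) uv(2) by (intro exI[of _ "v * D"]) auto
  qed (auto intro: exI[of _ 1])
  then show thesis using that by metis
qed

text \<open>Scaling by a common denominator turns the relation into an integer polynomial vanishing
  at \<zeta>; the nonzero factor \<open>D\<close> cancels after conjugation.\<close>

lemma root_of_unity_relation_conjugate:
  fixes c :: "nat \<Rightarrow> rat" and \<zeta> :: complex
  assumes n: "n > 0" and \<zeta>: "\<zeta> ^ n = 1"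
    and rel: "(\<Sum>k<n. of_rat (c k) * \<zeta> ^ k) = 0" and a: "coprime a n"
  shows "(\<Sum>k<n. of_rat (c k) * (\<zeta> ^ a) ^ k) = 0"
proof -
  obtain D d where D: "D \<noteq> 0" and d: "\<And>k. k \<in> {..<n} \<Longrightarrow> of_int D * c k = of_int (d k)"
    using common_denominator[of "{..<n}" c] by blast
  define f where "f = (\<Sum>k<n. monom (d k) k)"
  have f: "poly (map_poly of_int f) \<eta> = of_int D * (\<Sum>k<n. of_rat (c k) * \<eta> ^ k)" for \<eta> :: complex
  proof -
    have "poly (map_poly of_int f) \<eta> = (\<Sum>k<n. of_int (d k) * \<eta> ^ k)"
      by (simp add: f_def of_int_poly_hom.hom_sum poly_sum poly_monom map_poly_monom)
    also have "\<dots> = (\<Sum>k<n. of_int D * (of_rat (c k) * \<eta> ^ k))"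
    proof (rule sum.cong)
      fix k assume "k \<in> {..<n}"
      then have "of_rat (of_int D * c k) = (of_rat (of_int (d k)) :: complex)" by (simp only: d)
      then have "of_int D * of_rat (c k) = (of_int (d k) :: complex)" by (simp add: of_rat_mult)
      then show "of_int (d k) * \<eta> ^ k = of_int D * (of_rat (c k) * \<eta> ^ k)"
        by (simp flip: mult.assoc)
    qed simp
    finally show ?thesis by (simp add: sum_distrib_left)
  qed
  show ?thesis
    using int_poly_root_of_unity_conjugate[OF n \<zeta> _ a, of f] D rel by (simp add: f)
qed

section \<open>Vanishing sums of roots of unity\<close>

lemma primitive_root_of_unity_power_eq_1_iff:
  assumes "primitive_root_of_unity n \<zeta>"
  shows "\<zeta> ^ k = 1 \<longleftrightarrow> n dvd k"
proof -
  have n: "n > 0" and \<zeta>: "\<zeta> ^ n = 1" and min: "\<And>k. 0 < k \<Longrightarrow> k < n \<Longrightarrow> \<zeta> ^ k \<noteq> 1"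
    using assms by (auto simp: primitive_root_of_unity_def)
  have "\<zeta> ^ k = \<zeta> ^ (k mod n)" by (simp add: root_of_unity_power_mod[OF \<zeta>])
  also have "\<dots> = 1 \<longleftrightarrow> k mod n = 0"
    using min[of "k mod n"] n by (cases "k mod n = 0") auto
  finally show ?thesis by (simp add: dvd_eq_mod_eq_0)
qed

lemma primitive_root_of_unity_inj_on:
  assumes "primitive_root_of_unity n \<zeta>"
  shows "inj_on (\<lambda>k. \<zeta> ^ k) {..<n}"
proof (rule linorder_inj_onI)
  fix k l assume kl: "k < l" "k \<in> {..<n}" "l \<in> {..<n}"
  have "\<zeta> \<noteq> 0" using assms by (auto simp: primitive_root_of_unity_def zero_power)
  show "\<zeta> ^ k \<noteq> \<zeta> ^ l"
  proof
    assume "\<zeta> ^ k = \<zeta> ^ l"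
    also have "\<dots> = \<zeta> ^ k * \<zeta> ^ (l - k)" using kl by (simp flip: power_add)
    finally have "\<zeta> ^ (l - k) = 1" using \<open>\<zeta> \<noteq> 0\<close> by simp
    then have "n dvd l - k" using primitive_root_of_unity_power_eq_1_iff[OF assms] by simp
    with kl show False by (auto dest: dvd_imp_le)
  qed
qed auto

section \<open>Periodic functions and the finite Fourier transform\<close>

lemma periodic_mod:
  fixes h :: "nat \<Rightarrow> 'a"
  assumes "\<And>k. h (k + n) = h k"
  shows "h (k mod n) = h k"
proof -
  have "h (k + n * j) = h k" for k j
  proof (induction j)
    case (Suc j)
    then show ?case using assms[of "k + n * j"] by (simp add: ac_simps)
  qed simp
  from this[of "k mod n" "k div n"] show ?thesis by (simp add: mult.commute)
qed

text \<open>Each further shift trades the term \<open>h s\<close> for \<open>h (s + n)\<close>,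
  which has the same value.\<close>

lemma sum_shift_periodic:
  fixes h :: "nat \<Rightarrow> 'a::ab_group_add"
  assumes "\<And>k. h (k + n) = h k"
  shows "(\<Sum>k<n. h (k + s)) = (\<Sum>k<n. h k)"
proof (induction s)
  case (Suc s)
  have "h s + (\<Sum>k<n. h (k + Suc s)) = (\<Sum>k<Suc n. h (k + s))"
    by (subst sum.lessThan_Suc_shift) simp
  also have "\<dots> = h s + (\<Sum>k<n. h (k + s))"
    using assms[of s] by (simp add: add.commute)
  finally show ?case using Suc by simp
qed simp

text \<open>Translating the index by \<open>d\<close> leaves the sum unchanged but also multiplies
  it by \<open>\<zeta> ^ d\<close>, which is not 1.\<close>

lemma sum_periodic_roots_of_unity_eq_0:
  fixes g :: "nat \<Rightarrow> complex"
  assumes per: "\<And>k. g (k + d) = g k" and "d dvd n" and \<zeta>: "\<zeta> ^ n = 1" "\<zeta> ^ d \<noteq> 1"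
  shows "(\<Sum>k<n. g k * \<zeta> ^ k) = 0"
proof -
  let ?h = "\<lambda>k. g k * \<zeta> ^ k"
  have "g (k + n) = g k" for k
    using \<open>d dvd n\<close> periodic_mod[of g d, OF per]
    by (metis mod_add_self2 mod_add_cong mod_0 dvd_eq_mod_eq_0 add_0_right)
  then have "(\<Sum>k<n. ?h (k + d)) = sum ?h {..<n}"
    by (intro sum_shift_periodic) (simp add: power_add \<zeta>)
  then have "\<zeta> ^ d * sum ?h {..<n} = sum ?h {..<n}"
    by (simp add: per power_add sum_distrib_left mult_ac)
  with \<zeta>(2) show ?thesis by simp
qed

text \<open>Fourier inversion: twisting the transform at \<open>a\<close> by the inverse of
  \<open>\<zeta> ^ (a * j)\<close> and summing over \<open>a\<close> isolates \<open>n\<close> times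
  \<open>e j\<close>.\<close>

lemma discrete_Fourier_transform_eq_0:
  fixes e :: "nat \<Rightarrow> complex"
  assumes \<zeta>: "primitive_root_of_unity n \<zeta>"
    and e: "\<And>a. (\<Sum>k<n. e k * \<zeta> ^ (a * k)) = 0" and j: "j < n"
  shows "e j = 0"
proof -
  \<comment> \<open>The summand \<open>n - j\<close> stands for the exponent -j, to stay within
    natural numbers.\<close>
  have geo: "(\<Sum>a<n. (\<zeta> ^ (k + (n - j))) ^ a) = (if k = j then of_nat n else 0)" if "k < n" for k
  proof (cases "k = j")
    case True
    then show ?thesis using \<zeta> j by (simp add: primitive_root_of_unity_def)
  next
    case False
    have "\<not> n dvd k + (n - j)"
    proof
      assume "n dvd k + (n - j)"
      then have "[k + (n - j) = 0] (mod n)" by (simp add: cong_0_iff)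
      then have "[k + (n - j) + j = 0 + j] (mod n)" by (intro cong_add) auto
      then have "[k + n = j] (mod n)" using j by simp
      with that j False show False by (simp add: cong_def)
    qed
    then have "\<zeta> ^ (k + (n - j)) \<noteq> 1"
      using primitive_root_of_unity_power_eq_1_iff[OF \<zeta>] by blast
    moreover have "(\<zeta> ^ (k + (n - j))) ^ n = 1"
      using \<zeta> by (metis mult.commute power_mult power_one primitive_root_of_unity_def)
    ultimately show ?thesis using False by (simp add: geometric_sum)
  qed
  have "0 = (\<Sum>a<n. \<zeta> ^ (a * (n - j)) * (\<Sum>k<n. e k * \<zeta> ^ (a * k)))"
    by (simp add: e)
  also have "\<dots> = (\<Sum>a<n. \<Sum>k<n. e k * (\<zeta> ^ (k + (n - j))) ^ a)"
    unfolding sum_distrib_left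
    by (intro sum.cong refl) (simp add: power_add power_mult_distrib mult_ac flip: power_mult)
  also have "\<dots> = (\<Sum>k<n. e k * (\<Sum>a<n. (\<zeta> ^ (k + (n - j))) ^ a))"
    unfolding sum_distrib_left by (rule sum.swap)
  also have "\<dots> = (\<Sum>k<n. if k = j then e k * of_nat n else 0)"
    by (intro sum.cong) (auto simp: geo)
  also have "\<dots> = e j * of_nat n" using j by simp
  finally show ?thesis using j by simp
qed

text \<open>
  Subtracting from \<open>e\<close> its average over the translates by multiples of \<open>n div p\<close> kills its Fourier
  transform at the multiples of \<open>p\<close> and creates no new nonzero values elsewhere.
\<close>

lemma periodic_decomposition:
  fixes c :: "nat \<Rightarrow> rat" and p :: "'i \<Rightarrow> nat"
  assumes \<zeta>: "\<zeta> ^ n = (1 :: complex)" and per: "\<And>k. c (k + n) = c k"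
    and fin: "finite I" and p: "\<And>i. i \<in> I \<Longrightarrow> p i > 0 \<and> p i dvd n"
  defines "F \<equiv> \<lambda>e a. \<Sum>k<n. of_rat (e k) * \<zeta> ^ (a * k)"
  shows "\<exists>g e. (\<forall>i\<in>I. \<forall>k. g i (k + n div p i) = g i k) \<and> (\<forall>k. e (k + n) = e k) \<and>
    (\<forall>k. c k = (\<Sum>i\<in>I. g i k) + e k) \<and>
    (\<forall>a. F c a = 0 \<longrightarrow> F e a = 0) \<and> (\<forall>a. \<forall>i\<in>I. p i dvd a \<longrightarrow> F e a = 0)"
  using fin p
proof (induction I)
  case empty
  show ?case using per by (intro exI[of _ "\<lambda>_ _. 0"] exI[of _ c]) auto
next
  case (insert i I)
  then obtain g e where g: "\<And>j k. j \<in> I \<Longrightarrow> g j (k + n div p j) = g j k"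
    and e: "\<And>k. e (k + n) = e k" and c: "\<And>k. c k = (\<Sum>j\<in>I. g j k) + e k"
    and F1: "\<And>a. F c a = 0 \<Longrightarrow> F e a = 0" and F2: "\<And>a j. j \<in> I \<Longrightarrow> p j dvd a \<Longrightarrow> F e a = 0"
    by (metis insertI2)
  define q where "q = p i"
  define d where "d = n div q"
  have q: "q > 0" "q * d = n" using insert.prems by (auto simp: q_def d_def)
  define A where "A k = (\<Sum>j<q. e (k + j * d)) / of_nat q" for k
  have Aper: "A (k + d) = A k" for k
  proof -
    have "(\<Sum>j<q. e (k + d + j * d)) = (\<Sum>j<q. e (k + (j + 1) * d))"
      by (intro sum.cong) (auto simp: algebra_simps)
    also have "\<dots> = (\<Sum>j<q. e (k + j * d))"
    proof (rule sum_shift_periodic)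
      fix j show "e (k + (j + q) * d) = e (k + j * d)"
        using e[of "k + j * d"] q(2) by (simp add: algebra_simps)
    qed
    finally show ?thesis by (simp add: A_def)
  qed
  have Aper_n: "A (k + n) = A k" for k
  proof -
    have "e (k + n + j * d) = e (k + j * d)" for j
      using e[of "k + j * d"] by (simp add: ac_simps)
    then show ?thesis by (simp add: A_def)
  qed
  \<comment> \<open>Translation multiplies the transform by a root of unity, so it preserves
    zeros.\<close>
  have shift: "\<zeta> ^ (a * s) * F (\<lambda>k. e (k + s)) a = F e a" for a s
  proof -
    have "\<zeta> ^ (a * n) = 1" by (metis \<zeta> mult.commute power_mult power_one)
    then have "(\<Sum>k<n. of_rat (e (k + s)) * \<zeta> ^ (a * (k + s))) = F e a"
      unfolding F_def by (intro sum_shift_periodic) (simp add: e distrib_left power_add)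
    then show ?thesis
      by (simp add: F_def sum_distrib_left distrib_left power_add mult_ac)
  qed
  have FA: "F A a = (\<Sum>j<q. F (\<lambda>k. e (k + j * d)) a) / of_nat q" for a
    unfolding F_def A_def
    by (subst sum.swap) (simp add: of_rat_divide of_rat_sum sum_distrib_right sum_divide_distrib)
  have "n > 0 \<Longrightarrow> \<zeta> \<noteq> 0" using \<zeta> by (auto simp: zero_power)
  then have shift0: "F (\<lambda>k. e (k + s)) a = 0" if "F e a = 0" for a s
    using shift[of a s] that by (cases "n = 0") (auto simp: F_def)
  \<comment> \<open>At multiples of \<open>q\<close> this root of unity is 1: all translates, and so
    their average \<open>A\<close>, have the same transform as \<open>e\<close>.\<close>
  have shift1: "F (\<lambda>k. e (k + j * d)) a = F e a" if "q dvd a" for a j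
  proof -
    obtain b where "a = q * b" using \<open>q dvd a\<close> by (elim dvdE)
    then have "\<zeta> ^ (a * (j * d)) = (\<zeta> ^ n) ^ (b * j)"
      by (simp flip: power_mult q(2) add: mult_ac)
    then show ?thesis using shift[of a "j * d"] \<zeta> by simp
  qed
  have Fdiff: "F (\<lambda>k. e k - A k) a = F e a - F A a" for a
    by (simp add: F_def of_rat_diff left_diff_distrib sum_subtractf)
  show ?case
  \<comment> \<open>The average becomes the component of the new index, and \<open>e\<close> minus
    its average the new remainder.\<close>
  proof (intro exI[of _ "g(i := A)"] exI[of _ "\<lambda>k. e k - A k"] conjI ballI allI impI)
    fix j k assume "j \<in> insert i I"
    then show "(g(i := A)) j (k + n div p j) = (g(i := A)) j k"
      using g Aper by (auto simp: d_def q_def)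
  next
    fix k show "e (k + n) - A (k + n) = e k - A k" by (simp add: e Aper_n)
  next
    fix k
    have "(\<Sum>j\<in>I. (g(i := A)) j k) = (\<Sum>j\<in>I. g j k)"
      using insert.hyps by (intro sum.cong) auto
    then show "c k = (\<Sum>j\<in>insert i I. (g(i := A)) j k) + (e k - A k)"
      using insert.hyps c by simp
  next
    fix a assume "F c a = 0"
    then show "F (\<lambda>k. e k - A k) a = 0" using F1 by (simp add: Fdiff FA shift0)
  next
    fix a j assume "j \<in> insert i I" "p j dvd a"
    then consider "q dvd a" | "F e a = 0" using F2 by (auto simp: q_def)
    then show "F (\<lambda>k. e k - A k) a = 0"
      by cases (use q(1) in \<open>auto simp: Fdiff FA shift0 shift1\<close>)
  qed
qed

text \<open>A rational form of the theorem of Redei, de Bruijn and Schoenberg. The transform of the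
  remainder vanishes at residues prime to \<open>n\<close> by Galois conjugation and elsewhere
  because a prime shared with \<open>n\<close> is some \<open>p i\<close>; Fourier inversion then
  removes the remainder.\<close>

theorem vanishing_sum_of_roots_of_unity:
  fixes c :: "nat \<Rightarrow> rat" and p :: "'i \<Rightarrow> nat"
  assumes \<zeta>: "primitive_root_of_unity n \<zeta>" and fin: "finite I"
    and p: "\<And>i. i \<in> I \<Longrightarrow> p i > 0 \<and> p i dvd n"
    and cover: "\<And>q. prime q \<Longrightarrow> q dvd n \<Longrightarrow> q \<in> p ` I"
    and per: "\<And>k. c (k + n) = c k"
    and rel: "(\<Sum>k<n. of_rat (c k) * \<zeta> ^ k) = 0"
  obtains g where "\<And>i k. i \<in> I \<Longrightarrow> g i (k + n div p i) = g i k"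
    and "\<And>k. c k = (\<Sum>i\<in>I. g i k)"
proof -
  let ?F = "\<lambda>e a. \<Sum>k<n. of_rat (e k) * \<zeta> ^ (a * k)"
  have \<zeta>n: "\<zeta> ^ n = 1" and n: "n > 0" using \<zeta> by (auto simp: primitive_root_of_unity_def)
  have "\<exists>g e. (\<forall>i\<in>I. \<forall>k. g i (k + n div p i) = g i k) \<and> (\<forall>k. e (k + n) = e k) \<and>
    (\<forall>k. c k = (\<Sum>i\<in>I. g i k) + e k) \<and>
    (\<forall>a. ?F c a = 0 \<longrightarrow> ?F e a = 0) \<and> (\<forall>a. \<forall>i\<in>I. p i dvd a \<longrightarrow> ?F e a = 0)"
    using \<zeta>n per fin p by (rule periodic_decomposition)
  then obtain g e where g: "\<forall>i\<in>I. \<forall>k. g i (k + n div p i) = g i k"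
    and e: "\<forall>k. e (k + n) = e k" and c: "\<forall>k. c k = (\<Sum>i\<in>I. g i k) + e k"
    and F1: "\<forall>a. ?F c a = 0 \<longrightarrow> ?F e a = 0"
    and F2: "\<forall>a. \<forall>i\<in>I. p i dvd a \<longrightarrow> ?F e a = 0"
    by (elim exE conjE)
  have F: "?F e a = 0" for a
  proof (cases "coprime a n")
    case True
    then show ?thesis
      using root_of_unity_relation_conjugate[OF n \<zeta>n rel] by (intro F1[rule_format]) (simp add: power_mult)
  next
    case False
    then obtain q where "prime q" "q dvd a" "q dvd n"
      using prime_factor_nat[of "gcd a n"] by (auto simp: coprime_iff_gcd_eq_1)
    then show ?thesis using cover F2 by blast
  qed
  have "e k = 0" if "k < n" for k
    using discrete_Fourier_transform_eq_0[OF \<zeta> F that] by simp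
  then have "e k = 0" for k
    using periodic_mod[of e n k] e n by (metis mod_less_divisor)
  with c g show thesis by (intro that[of g]) auto
qed

section \<open>Duals of represented matroids and of direct sums\<close>

text \<open>A basis of the span stays independent when \<open>x\<close> is added, so a functional
  can be prescribed as 0 on the basis and 1 at \<open>x\<close>.\<close>

lemma (in vector_space) exists_linear_separating_span:
  assumes "x \<notin> span S"
  obtains \<phi> where "Vector_Spaces.linear scale (*) \<phi>" and "\<And>y. y \<in> span S \<Longrightarrow> \<phi> y = 0" and "\<phi> x = 1"
proof -
  interpret vector_space_pair scale "(*) :: 'a \<Rightarrow> 'a \<Rightarrow> 'a"
    by unfold_locales (simp_all add: algebra_simps)
  obtain B where B: "independent B" "S \<subseteq> span B" "B \<subseteq> S"
    using maximal_independent_subset by blast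
  have span: "span B = span S"
    using B by (metis span_mono span_span subset_antisym)
  have xB: "x \<notin> span B" using assms span by simp
  then have x: "x \<notin> B" using span_base by blast
  have indep: "independent (insert x B)" using x xB B(1) by (simp add: independent_insert)
  obtain \<phi> where \<phi>: "Vector_Spaces.linear scale (*) \<phi>"
    "\<forall>y\<in>insert x B. \<phi> y = (if y = x then 1 else 0)"
    using linear_independent_extend[OF indep, of "\<lambda>y. if y = x then 1 else 0"] by blast
  show thesis
  proof (rule that[OF \<phi>(1)])
    fix y assume "y \<in> span S"
    then show "\<phi> y = 0"
      unfolding span[symmetric]
      by (rule linear_eq_0_on_span[OF \<phi>(1), rotated]) (use \<phi>(2) x in auto)
  qed (use \<phi>(2) in simp)
qed

lemma (in vector_space) mem_indeps_dual_represented_matroid_iff_span: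
  assumes "finite E"
  shows "J \<in> indeps (dual_matroid (represented_matroid scale E v)) \<longleftrightarrow>
    J \<subseteq> E \<and> v ` E \<subseteq> span (v ` (E - J))"
proof
  assume "J \<in> indeps (dual_matroid (represented_matroid scale E v))"
  then obtain B where B: "B \<subseteq> E" "inj_on v B" "independent (v ` B)" and J: "J \<subseteq> E - B"
    and max: "\<And>I. \<lbrakk>I \<subseteq> E; inj_on v I; independent (v ` I); B \<subseteq> I\<rbrakk> \<Longrightarrow> I = B"
    by (auto simp: dual_matroid_def bases_def represented_matroid_def)
  have "v e \<in> span (v ` B)" if "e \<in> E" for e
  proof (rule ccontr)
    assume n: "v e \<notin> span (v ` B)"
    then have "v e \<notin> v ` B" using span_base by blast
    with n B that have "insert e B = B"
      by (intro max) (auto simp: independent_insert)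
    with \<open>v e \<notin> v ` B\<close> show False by blast
  qed
  moreover have "span (v ` B) \<subseteq> span (v ` (E - J))"
    using B J by (intro span_mono) auto
  ultimately show "J \<subseteq> E \<and> v ` E \<subseteq> span (v ` (E - J))" using J by auto
next
  assume J: "J \<subseteq> E \<and> v ` E \<subseteq> span (v ` (E - J))"
  obtain C where C: "C \<subseteq> v ` (E - J)" "independent C" "v ` (E - J) \<subseteq> span C"
    using maximal_independent_subset by blast
  \<comment> \<open>One label is chosen for each basis vector, which makes \<open>v\<close>
    injective on \<open>B\<close>.\<close>
  obtain B where B: "B \<subseteq> E - J" "inj_on v B" "C = v ` B"
    using C(1) by (auto simp: subset_image_inj)
  have E: "v ` E \<subseteq> span (v ` B)"
    using J C(3) B(3) by (metis span_mono span_span subset_trans)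
  have "I = B" if I: "I \<subseteq> E" "inj_on v I" "independent (v ` I)" "B \<subseteq> I" for I
  proof (rule ccontr)
    assume "I \<noteq> B"
    then obtain e where e: "e \<in> I" "e \<notin> B" using I(4) by blast
    then have "v e \<notin> v ` B" using I by (meson inj_on_image_mem_iff)
    moreover have "independent (insert (v e) (v ` B))"
      using I e by (intro independent_mono[OF I(3)]) auto
    ultimately have "v e \<notin> span (v ` B)" by (simp add: independent_insert)
    with E e I show False by auto
  qed
  with B C(2) J show "J \<in> indeps (dual_matroid (represented_matroid scale E v))"
    by (auto simp: dual_matroid_def bases_def represented_matroid_def intro!: exI[of _ B])
qed

text \<open>
  Thus the circuits of the dual are the minimal nonempty supports of the functions
  \<open>e \<mapsto> \<phi> (v e)\<close>, that is, of the elements of the row space.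
\<close>

lemma (in vector_space) mem_indeps_dual_represented_matroid_iff:
  assumes "finite E"
  shows "J \<in> indeps (dual_matroid (represented_matroid scale E v)) \<longleftrightarrow>
    J \<subseteq> E \<and> (\<forall>\<phi>. Vector_Spaces.linear scale (*) \<phi> \<longrightarrow>
      (\<forall>e\<in>E - J. \<phi> (v e) = 0) \<longrightarrow> (\<forall>e\<in>E. \<phi> (v e) = 0))"
proof -
  interpret vector_space_pair scale "(*) :: 'a \<Rightarrow> 'a \<Rightarrow> 'a"
    by unfold_locales (simp_all add: algebra_simps)
  have "v ` E \<subseteq> span (v ` (E - J)) \<longleftrightarrow> (\<forall>\<phi>. Vector_Spaces.linear scale (*) \<phi> \<longrightarrow>
      (\<forall>e\<in>E - J. \<phi> (v e) = 0) \<longrightarrow> (\<forall>e\<in>E. \<phi> (v e) = 0))" (is "?L \<longleftrightarrow> ?R")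
  proof
    assume L: ?L
    show ?R
    proof (intro allI impI ballI)
      fix \<phi> e assume \<phi>: "Vector_Spaces.linear scale (*) \<phi>" "\<forall>e\<in>E - J. \<phi> (v e) = 0" and "e \<in> E"
      then have e: "v e \<in> span (v ` (E - J))" using L by blast
      show "\<phi> (v e) = 0"
        by (rule linear_eq_0_on_span[OF \<phi>(1) _ e]) (use \<phi>(2) in blast)
    qed
  next
    assume R: ?R
    show ?L
    proof (rule ccontr)
      assume "\<not> ?L"
      then obtain e where e: "e \<in> E" "v e \<notin> span (v ` (E - J))" by blast
      obtain \<phi> where \<phi>: "Vector_Spaces.linear scale (*) \<phi>"
        "\<And>y. y \<in> span (v ` (E - J)) \<Longrightarrow> \<phi> y = 0" "\<phi> (v e) = 1"
        using exists_linear_separating_span[OF e(2)] by blast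
      have "\<forall>e\<in>E - J. \<phi> (v e) = 0" by (intro ballI \<phi>(2) span_base imageI)
      then have "\<phi> (v e) = 0" using R \<phi>(1) e(1) by blast
      with \<phi>(3) show False by simp
    qed
  qed
  then show ?thesis
    by (simp only: mem_indeps_dual_represented_matroid_iff_span[OF assms])
qed

section \<open>Direct sums and their duals\<close>

text \<open>Maximality can be tested slice by slice, since one slice can be enlarged while the
  others stay fixed.\<close>

lemma bases_direct_sum_matroid:
  "B \<in> bases (direct_sum_matroid K M) \<longleftrightarrow>
    B \<subseteq> (SIGMA k:K. ground (M k)) \<and> (\<forall>k\<in>K. {e. (k, e) \<in> B} \<in> bases (M k))"
  if M: "\<And>k. k \<in> K \<Longrightarrow> indeps (M k) \<subseteq> Pow (ground (M k))"
proof (intro iffI conjI ballI)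
  assume B: "B \<in> bases (direct_sum_matroid K M)"
  then show sub: "B \<subseteq> (SIGMA k:K. ground (M k))"
    by (simp add: bases_def direct_sum_matroid_def)
  fix k assume k: "k \<in> K"
  show "{e. (k, e) \<in> B} \<in> bases (M k)"
    unfolding bases_def
  proof (intro CollectI conjI ballI impI)
    show "{e. (k, e) \<in> B} \<in> indeps (M k)"
      using B k by (simp add: bases_def direct_sum_matroid_def)
    fix I assume I: "I \<in> indeps (M k)" "{e. (k, e) \<in> B} \<subseteq> I"
    define B' where "B' = B \<union> {k} \<times> I"
    have slice: "{e. (l, e) \<in> B'} = (if l = k then I else {e. (l, e) \<in> B})" for l
      using I by (auto simp: B'_def)
    have "B' \<in> indeps (direct_sum_matroid K M)"
      unfolding direct_sum_matroid_def matroid.simps mem_Collect_eq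
    proof (intro conjI ballI)
      show "B' \<subseteq> (SIGMA k:K. ground (M k))"
        using I(1) M[OF k] k sub by (fastforce simp: B'_def)
      fix l assume "l \<in> K"
      then have "{e. (l, e) \<in> B} \<in> indeps (M l)"
        using B by (simp add: bases_def direct_sum_matroid_def)
      then show "{e. (l, e) \<in> B'} \<in> indeps (M l)"
        using I(1) by (cases "l = k") (simp_all only: slice if_True if_False simp_thms)
    qed
    then have "B' = B" using B by (simp add: bases_def B'_def)
    then show "I = {e. (k, e) \<in> B}" using slice[of k] by simp
  qed
next
  assume B: "B \<subseteq> (SIGMA k:K. ground (M k)) \<and> (\<forall>k\<in>K. {e. (k, e) \<in> B} \<in> bases (M k))"
  show "B \<in> bases (direct_sum_matroid K M)"
    unfolding bases_def
  proof (intro CollectI conjI ballI impI)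
    show "B \<in> indeps (direct_sum_matroid K M)"
      using B by (auto simp: bases_def direct_sum_matroid_def)
    fix I assume I: "I \<in> indeps (direct_sum_matroid K M)" "B \<subseteq> I"
    have "{e. (k, e) \<in> I} = {e. (k, e) \<in> B}" if "k \<in> K" for k
    proof -
      have "{e. (k, e) \<in> I} \<in> indeps (M k)" "{e. (k, e) \<in> B} \<subseteq> {e. (k, e) \<in> I}"
        using I that by (auto simp: direct_sum_matroid_def)
      then show ?thesis using B that by (simp add: bases_def)
    qed
    moreover have "fst x \<in> K" if "x \<in> I" for x
      using I that by (auto simp: direct_sum_matroid_def)
    ultimately show "I = B" using I(2) by fastforce
  qed
qed

text \<open>Bases and complements are both formed slice by slice. This reduces the duality to a
  single simplicial matroid.\<close>

lemma mem_indeps_dual_direct_sum_matroid_iff: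
  assumes M: "\<And>k. k \<in> K \<Longrightarrow> indeps (M k) \<subseteq> Pow (ground (M k))"
  shows "J \<in> indeps (dual_matroid (direct_sum_matroid K M)) \<longleftrightarrow>
    J \<subseteq> (SIGMA k:K. ground (M k)) \<and>
    (\<forall>k\<in>K. {e. (k, e) \<in> J} \<in> indeps (dual_matroid (M k)))"
proof
  assume "J \<in> indeps (dual_matroid (direct_sum_matroid K M))"
  then obtain B where "B \<in> bases (direct_sum_matroid K M)"
    and J: "J \<subseteq> (SIGMA k:K. ground (M k)) - B"
    by (auto simp: dual_matroid_def direct_sum_matroid_def)
  then have B: "\<forall>k\<in>K. {e. (k, e) \<in> B} \<in> bases (M k)"
    by (simp add: bases_direct_sum_matroid[OF M])
  have "{e. (k, e) \<in> J} \<in> indeps (dual_matroid (M k))" if "k \<in> K" for k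
  proof -
    have "{e. (k, e) \<in> J} \<subseteq> ground (M k) - {e. (k, e) \<in> B}" using J by blast
    moreover have "{e. (k, e) \<in> B} \<in> bases (M k)" using B that by blast
    ultimately show ?thesis unfolding dual_matroid_def matroid.simps mem_Collect_eq by (rule bexI)
  qed
  with J show "J \<subseteq> (SIGMA k:K. ground (M k)) \<and>
    (\<forall>k\<in>K. {e. (k, e) \<in> J} \<in> indeps (dual_matroid (M k)))" by blast
next
  assume J: "J \<subseteq> (SIGMA k:K. ground (M k)) \<and>
    (\<forall>k\<in>K. {e. (k, e) \<in> J} \<in> indeps (dual_matroid (M k)))"
  then have "\<forall>k\<in>K. \<exists>B. B \<in> bases (M k) \<and> {e. (k, e) \<in> J} \<subseteq> ground (M k) - B"
    unfolding dual_matroid_def matroid.simps mem_Collect_eq by blast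
  then obtain B where B: "\<And>k. k \<in> K \<Longrightarrow> B k \<in> bases (M k)"
    "\<And>k. k \<in> K \<Longrightarrow> {e. (k, e) \<in> J} \<subseteq> ground (M k) - B k"
    by metis
  have "{e. (k, e) \<in> Sigma K B} = B k" if "k \<in> K" for k using that by auto
  moreover have "B k \<subseteq> ground (M k)" if "k \<in> K" for k
    using B(1)[OF that] M[OF that] by (auto simp: bases_def)
  ultimately have "Sigma K B \<in> bases (direct_sum_matroid K M)"
    using B(1) by (simp add: bases_direct_sum_matroid[OF M] Sigma_mono)
  moreover have "J \<subseteq> (SIGMA k:K. ground (M k)) - Sigma K B"
    using J B(2) by blast
  moreover have "ground (direct_sum_matroid K M) = (SIGMA k:K. ground (M k))"
    by (simp add: direct_sum_matroid_def)
  ultimately show "J \<in> indeps (dual_matroid (direct_sum_matroid K M))"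
    unfolding dual_matroid_def matroid.simps mem_Collect_eq by metis
qed

text \<open>Extending coefficients by zero from \<open>I\<close> to \<open>E\<close> gives the
  criterion the same shape as the one for duals: no nonzero relation is supported in
  \<open>I\<close>.\<close>

lemma (in vector_space) mem_indeps_represented_matroid_id_iff:
  assumes "finite E"
  shows "I \<in> indeps (represented_matroid scale E (\<lambda>z. z)) \<longleftrightarrow> I \<subseteq> E \<and>
    (\<forall>u. (\<forall>z\<in>E - I. u z = 0) \<longrightarrow> (\<Sum>z\<in>E. scale (u z) z) = 0 \<longrightarrow> (\<forall>z\<in>E. u z = 0))"
proof (cases "I \<subseteq> E")
  case True
  have fin: "finite I" using True assms finite_subset by blast
  have "independent I \<longleftrightarrow> (\<forall>u. (\<Sum>z\<in>I. scale (u z) z) = 0 \<longrightarrow> (\<forall>z\<in>I. u z = 0))"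
    unfolding dependent_finite[OF fin] by blast
  also have "\<dots> \<longleftrightarrow> (\<forall>u. (\<forall>z\<in>E - I. u z = 0) \<longrightarrow> (\<Sum>z\<in>E. scale (u z) z) = 0 \<longrightarrow> (\<forall>z\<in>E. u z = 0))"
    (is "?L \<longleftrightarrow> ?R")
  proof
    assume L: ?L
    show ?R
    proof (intro allI impI)
      fix u assume u: "\<forall>z\<in>E - I. u z = 0" "(\<Sum>z\<in>E. scale (u z) z) = 0"
      have "(\<Sum>z\<in>I. scale (u z) z) = (\<Sum>z\<in>E. scale (u z) z)"
        using assms True u(1) by (intro sum.mono_neutral_left) auto
      with L u show "\<forall>z\<in>E. u z = 0" by auto
    qed
  next
    assume R: ?R
    show ?L
    proof (intro allI impI)
      fix u assume u: "(\<Sum>z\<in>I. scale (u z) z) = 0"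
      define u' where "u' z = (if z \<in> I then u z else 0)" for z
      have "(\<Sum>z\<in>E. scale (u' z) z) = (\<Sum>z\<in>I. scale (u' z) z)"
        using assms True by (intro sum.mono_neutral_right) (auto simp: u'_def)
      also have "\<dots> = 0" using u by (simp add: u'_def cong: sum.cong)
      finally have "(\<Sum>z\<in>E. scale (u' z) z) = 0" .
      moreover have "\<forall>z\<in>E - I. u' z = 0" by (simp add: u'_def)
      ultimately have "\<forall>z\<in>E. u' z = 0" using R by blast
      with True show "\<forall>z\<in>I. u z = 0" by (auto simp: u'_def split: if_splits)
    qed
  qed
  finally show ?thesis using True by (simp add: represented_matroid_def)
qed (simp add: represented_matroid_def)

section \<open>Facets of a join of points\<close>

text \<open>A single number encodes the chosen vertices through its residues. Index set
  \<open>{..<r}\<close> gives facets, and omitting one index gives their codimension one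
  faces.\<close>

definition join_face :: "(nat \<Rightarrow> nat) \<Rightarrow> nat set \<Rightarrow> nat \<Rightarrow> (nat \<times> nat) set" where
  "join_face p A x = (\<lambda>i. (i, x mod p i)) ` A"

lemma mem_join_face: "(i, j) \<in> join_face p A x \<longleftrightarrow> i \<in> A \<and> j = x mod p i"
  by (auto simp: join_face_def)

lemma join_face_eq_iff:
  "join_face p A x = join_face p B y \<longleftrightarrow> A = B \<and> (\<forall>i\<in>A. [x = y] (mod p i))"
proof
  assume eq: "join_face p A x = join_face p B y"
  have "i \<in> A \<longleftrightarrow> i \<in> B" for i
    using eq mem_join_face by metis
  moreover have "x mod p i = y mod p i" if "i \<in> A" for i
    using eq that mem_join_face by metis
  ultimately show "A = B \<and> (\<forall>i\<in>A. [x = y] (mod p i))" by (auto simp: cong_def)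
next
  assume "A = B \<and> (\<forall>i\<in>A. [x = y] (mod p i))"
  then show "join_face p A x = join_face p B y"
    unfolding join_face_def by (intro image_cong) (auto simp: cong_def)
qed

text \<open>The vertex of index \<open>i\<close> is preceded lexicographically by exactly one vertex
  for each smaller index, whence the sign.\<close>

lemma boundary_join_face:
  "boundary lex_less (Poly_Mapping.single (join_face p {..<r} x) 1) =
    (\<Sum>i<r. Poly_Mapping.single (join_face p ({..<r} - {i}) x) ((- 1) ^ i))"
proof -
  let ?F = "join_face p {..<r} x" and ?v = "\<lambda>i. (i, x mod p i)"
  have inj: "inj_on ?v A" for A by (auto simp: inj_on_def)
  have "boundary lex_less (Poly_Mapping.single ?F 1) =
      (\<Sum>i<r. Poly_Mapping.single (?F - {?v i}) ((- 1) ^ card {w \<in> ?F. (w, ?v i) \<in> lex_less}))"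
    unfolding boundary_single by (simp add: join_face_def sum.reindex[OF inj])
  also have "\<dots> = (\<Sum>i<r. Poly_Mapping.single (join_face p ({..<r} - {i}) x) ((- 1) ^ i))"
  proof (rule sum.cong)
    fix i assume "i \<in> {..<r}"
    then have "{w \<in> ?F. (w, ?v i) \<in> lex_less} = ?v ` {..<i}"
      by (auto simp: join_face_def lex_less_def)
    then have "card {w \<in> ?F. (w, ?v i) \<in> lex_less} = i"
      by (simp add: card_image[OF inj])
    moreover have "?F - {?v i} = join_face p ({..<r} - {i}) x"
      by (auto simp: join_face_def)
    ultimately show "Poly_Mapping.single (?F - {?v i}) ((- 1) ^ card {w \<in> ?F. (w, ?v i) \<in> lex_less}) =
        Poly_Mapping.single (join_face p ({..<r} - {i}) x) ((- 1) ^ i)" by simp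
  qed simp
  finally show ?thesis .
qed

text \<open>A face has at most one vertex per factor, so the top ones choose a vertex from every
  factor; the Chinese remainder theorem encodes this choice by a number below the product.\<close>

lemma top_faces_join_of_points:
  assumes pos: "\<And>i. i < r \<Longrightarrow> p i > 0"
    and cop: "\<And>i j. \<lbrakk>i < r; j < r; i \<noteq> j\<rbrakk> \<Longrightarrow> coprime (p i) (p j)"
  shows "top_faces (join_of_points r p) = join_face p {..<r} ` {..<\<Prod>i<r. p i}"
proof -
  let ?\<Delta> = "join_of_points r p"
  have face: "join_face p {..<r} x \<in> ?\<Delta>" "card (join_face p {..<r} x) = r" for x
    using pos by (auto simp: join_of_points_iff join_face_def card_image inj_on_def)
  have card: "card F \<le> r" "card F = r \<Longrightarrow> fst ` F = {..<r}" if "F \<in> ?\<Delta>" for F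
  proof -
    have F: "F \<subseteq> (SIGMA i:{..<r}. {..<p i})" "inj_on fst F"
      using that by (auto simp: join_of_points_iff inj_on_def)
    then have sub: "fst ` F \<subseteq> {..<r}" by auto
    have eq: "card (fst ` F) = card F" by (rule card_image[OF F(2)])
    show "card F \<le> r" using card_mono[OF _ sub] eq by simp
    show "fst ` F = {..<r}" if "card F = r"
      using card_subset_eq[OF _ sub] eq that by simp
  qed
  have "?\<Delta> \<subseteq> Pow (SIGMA i:{..<r}. {..<p i})"
    by (auto simp: join_of_points_iff)
  then have "finite ?\<Delta>" by (rule finite_subset) simp
  then have Max: "Max (card ` ?\<Delta>) = r"
    using card face[of 0] by (intro Max_eqI) (auto intro: rev_image_eqI)
  have "F \<in> join_face p {..<r} ` {..<\<Prod>i<r. p i}" if F: "F \<in> ?\<Delta>" "card F = r" for F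
  proof -
    have "\<forall>i\<in>{..<r}. \<exists>j. (i, j) \<in> F" using card(2)[OF F] by (metis imageE prod.collapse)
    then obtain u where u: "\<And>i. i < r \<Longrightarrow> (i, u i) \<in> F" by (metis lessThan_iff)
    have "\<exists>!x. x < (\<Prod>i<r. p i) \<and> (\<forall>i\<in>{..<r}. [x = u i] (mod p i))"
      using pos cop by (intro chinese_remainder_unique_nat) auto
    then obtain x where x: "x < (\<Prod>i<r. p i)" "\<forall>i\<in>{..<r}. [x = u i] (mod p i)" by blast
    have "x mod p i = u i" if "i < r" for i
      using x(2) u[OF that] F(1) that by (auto simp: cong_def join_of_points_iff)
    then have "join_face p {..<r} x \<subseteq> F"
      using u by (auto simp: join_face_def)
    moreover have "finite F"
      using F(1) by (auto simp: join_of_points_iff intro: finite_subset)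
    ultimately have "join_face p {..<r} x = F"
      using face(2) F(2) by (intro card_subset_eq) auto
    with x(1) show ?thesis by blast
  qed
  then show ?thesis
    using face by (auto simp: top_faces_def Max)
qed

section \<open>Cochains and coboundaries\<close>

text \<open>Simplices form a basis of the chain space, so every cochain \<psi> extends to a
  functional.\<close>

lemma chain_linear_functional:
  fixes \<psi> :: "'v set \<Rightarrow> rat"
  obtains \<phi> where "Vector_Spaces.linear chain_scale (*) \<phi>"
    and "\<And>F. \<phi> (Poly_Mapping.single F 1) = \<psi> F"
proof -
  define \<phi> where "\<phi> c = (\<Sum>F\<in>Poly_Mapping.keys c. Poly_Mapping.lookup c F * \<psi> F)" for c
  have \<phi>: "\<phi> c = (\<Sum>F\<in>S. Poly_Mapping.lookup c F * \<psi> F)"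
    if "finite S" "Poly_Mapping.keys c \<subseteq> S" for c S
    unfolding \<phi>_def using that by (intro sum.mono_neutral_left) (auto simp: in_keys_iff)
  have "\<phi> (c + d) = \<phi> c + \<phi> d" for c d
  proof -
    let ?S = "Poly_Mapping.keys c \<union> Poly_Mapping.keys d"
    have "\<phi> (c + d) = (\<Sum>F\<in>?S. Poly_Mapping.lookup (c + d) F * \<psi> F)"
      by (rule \<phi>) (simp_all add: keys_add)
    also have "\<dots> = \<phi> c + \<phi> d"
      by (simp add: \<phi>[of ?S] lookup_add distrib_right sum.distrib)
    finally show ?thesis .
  qed
  moreover have "\<phi> (chain_scale q c) = q * \<phi> c" for q c
  proof -
    have "\<phi> (chain_scale q c) =
        (\<Sum>F\<in>Poly_Mapping.keys c. Poly_Mapping.lookup (chain_scale q c) F * \<psi> F)"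
      by (rule \<phi>) (auto simp: in_keys_iff)
    then show ?thesis by (simp add: \<phi>_def sum_distrib_left mult.assoc)
  qed
  moreover have "vector_space ((*) :: rat \<Rightarrow> rat \<Rightarrow> rat)"
    by unfold_locales (simp_all add: algebra_simps)
  ultimately have "Vector_Spaces.linear chain_scale (*) \<phi>"
    by (simp add: Vector_Spaces.linear_iff vector_space_chain_scale)
  then show thesis by (rule that) (simp add: \<phi>_def)
qed

text \<open>The composite of \<phi> with the boundary is the coboundary of the cochain given by
  \<phi>. Rows of the simplicial matroid thus come from values on codimension one faces.\<close>

lemma linear_boundary_join_face:
  assumes "Vector_Spaces.linear chain_scale (*) \<phi>"
  shows "\<phi> (boundary lex_less (Poly_Mapping.single (join_face p {..<r} x) 1)) =
    (\<Sum>i<r. (- 1) ^ i * \<phi> (Poly_Mapping.single (join_face p ({..<r} - {i}) x) 1))"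
proof -
  interpret Vector_Spaces.linear chain_scale "(*)" \<phi> by fact
  have single: "Poly_Mapping.single F a = chain_scale a (Poly_Mapping.single F 1)"
    for a and F :: "(nat \<times> nat) set"
    by (rule poly_mapping_eqI) (simp add: lookup_single when_def)
  have scale1: "\<phi> (Poly_Mapping.single F a) = a * \<phi> (Poly_Mapping.single F 1)"
    for a and F :: "(nat \<times> nat) set"
    by (subst single) (rule scale)
  show ?thesis
    unfolding boundary_join_face sum by (intro sum.cong refl scale1)
qed

section \<open>Duality\<close>

text \<open>Since the powers are distinct, coefficients on roots of unity may be replaced by
  functions of the exponent, on which translation acts.\<close>

lemma mem_indeps_cyclotomic_matroid_iff:
  assumes \<zeta>: "primitive_root_of_unity n \<zeta>" and A: "A \<subseteq> {..<n}"
  shows "(\<lambda>k. \<zeta> ^ k) ` A \<in> indeps (cyclotomic_matroid n \<zeta>) \<longleftrightarrow>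
    (\<forall>c :: nat \<Rightarrow> rat. (\<forall>k\<in>{..<n} - A. c k = 0) \<longrightarrow> (\<Sum>k<n. of_rat (c k) * \<zeta> ^ k) = 0 \<longrightarrow>
      (\<forall>k<n. c k = 0))"
proof -
  interpret vector_space rat_scale by (rule vector_space_rat_scale)
  let ?w = "\<lambda>k. \<zeta> ^ k"
  have inj: "inj_on ?w {..<n}" by (rule primitive_root_of_unity_inj_on[OF \<zeta>])
  have diff: "?w ` {..<n} - ?w ` A = ?w ` ({..<n} - A)"
    using inj_on_image_set_diff[OF inj, of "{..<n}" A] A by auto
  have "?w ` A \<in> indeps (cyclotomic_matroid n \<zeta>) \<longleftrightarrow>
    (\<forall>u. (\<forall>k\<in>{..<n} - A. u (?w k) = 0) \<longrightarrow> (\<Sum>k<n. of_rat (u (?w k)) * ?w k) = 0 \<longrightarrow>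
      (\<forall>k<n. u (?w k) = 0))"
    unfolding cyclotomic_matroid_def
    by (subst mem_indeps_represented_matroid_id_iff)
      (use A in \<open>auto simp: diff sum.reindex[OF inj] rat_scale_def image_mono\<close>)
  also have "\<dots> \<longleftrightarrow> (\<forall>c :: nat \<Rightarrow> rat. (\<forall>k\<in>{..<n} - A. c k = 0) \<longrightarrow>
      (\<Sum>k<n. of_rat (c k) * \<zeta> ^ k) = 0 \<longrightarrow> (\<forall>k<n. c k = 0))" (is "?L \<longleftrightarrow> ?R")
  proof
    assume L: ?L
    show ?R
    proof (intro allI impI)
      fix c :: "nat \<Rightarrow> rat" and k
      assume c: "\<forall>k\<in>{..<n} - A. c k = 0" "(\<Sum>k<n. of_rat (c k) * \<zeta> ^ k) = 0" and k: "k < n"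
      define u where "u z = c (the_inv_into {..<n} ?w z)" for z
      have u: "u (?w l) = c l" if "l \<in> {..<n}" for l
        using the_inv_into_f_f[OF inj that] by (simp add: u_def)
      have "\<forall>k\<in>{..<n} - A. u (?w k) = 0" using c(1) u by simp
      moreover have "(\<Sum>k<n. of_rat (u (?w k)) * ?w k) = 0"
      proof -
        have "(\<Sum>k<n. of_rat (u (?w k)) * ?w k) = (\<Sum>k<n. of_rat (c k) * ?w k)"
          by (intro sum.cong) (simp_all only: u)
        then show ?thesis using c(2) by simp
      qed
      ultimately have "\<forall>k<n. u (?w k) = 0" using L by blast
      then show "c k = 0" using k u by simp
    qed
  next
    assume R: ?R
    show ?L
    proof (rule allI)
      fix u :: "complex \<Rightarrow> rat"
      show "(\<forall>k\<in>{..<n} - A. u (?w k) = 0) \<longrightarrow> (\<Sum>k<n. of_rat (u (?w k)) * ?w k) = 0 \<longrightarrow>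
          (\<forall>k<n. u (?w k) = 0)"
        using R[rule_format, of "\<lambda>k. u (?w k)"] by blast
    qed
  qed
  finally show ?thesis .
qed

text \<open>Both ground sets are labelled by \<open>K\<close>, here the exponents below
  \<open>n\<close>; undoing one labelling and applying the other is the isomorphism.\<close>

lemma matroid_isoI:
  assumes "bij_betw w K (ground M)" and "bij_betw h K (ground N)"
    and "\<And>A. A \<subseteq> K \<Longrightarrow> w ` A \<in> indeps M \<longleftrightarrow> h ` A \<in> indeps N"
  shows "matroid_iso M N"
proof -
  let ?f = "h \<circ> the_inv_into K w"
  have "bij_betw ?f (ground M) (ground N)"
    using bij_betw_trans[OF bij_betw_the_inv_into[OF assms(1)] assms(2)] .
  moreover have "I \<in> indeps M \<longleftrightarrow> ?f ` I \<in> indeps N" if "I \<subseteq> ground M" for I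
  proof -
    have w: "inj_on w K" "w ` K = ground M"
      using assms(1) by (simp_all add: bij_betw_def)
    obtain A where A: "A \<subseteq> K" "I = w ` A"
      using \<open>I \<subseteq> ground M\<close> unfolding w(2)[symmetric] subset_image_iff by blast
    have "the_inv_into K w ` w ` A = A"
      by (simp add: image_image the_inv_into_f_f[OF w(1)] subsetD[OF A(1)] cong: image_cong_simp)
    then have "?f ` I = h ` A" by (simp only: A(2) image_comp[symmetric])
    then show ?thesis using assms(3)[OF A(1)] A(2) by simp
  qed
  ultimately show ?thesis unfolding matroid_iso_def by blast
qed

text \<open>
  The residue class of \<open>k\<close> modulo the product \<open>N\<close> selects the copy of the simplicial matroid, and
  the Chinese remainder theorem turns \<open>k div N\<close> into a facet. Translation by \<open>n div p i\<close> then keeps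
  the copy and moves the facet through the vertices of the \<open>i\<close>-th factor, so coboundaries of
  codimension one faces correspond, up to signs, to the relations expressing that the \<open>p i\<close>-th
  roots of unity sum to zero.
\<close>

locale cyclotomic_join =
  fixes r N n :: nat and p :: "nat \<Rightarrow> nat" and \<zeta> :: complex
  assumes prime: "\<And>i. i < r \<Longrightarrow> prime (p i)"
    and inj: "inj_on p {..<r}"
    and n_eq: "n = N * (\<Prod>i<r. p i)"
    and cover: "\<And>q. prime q \<Longrightarrow> q dvd n \<Longrightarrow> q \<in> p ` {..<r}"
    and prim: "primitive_root_of_unity n \<zeta>"
begin

abbreviation "facet \<equiv> join_face p {..<r}"
abbreviation "ridge i \<equiv> join_face p ({..<r} - {i})"
abbreviation "facet_boundary F \<equiv> boundary lex_less (Poly_Mapping.single F (1 :: rat))"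
definition "copy_facet k = (k mod N, facet (k div N))"

lemma n_pos: "n > 0"
  using prim by (simp add: primitive_root_of_unity_def)

lemma N_pos: "N > 0"
  using n_pos by (auto simp: n_eq)

lemma \<zeta>_power_n: "\<zeta> ^ n = 1"
  using prim by (simp add: primitive_root_of_unity_def)

lemma coprime: "coprime (p i) (p j)" if "i < r" "j < r" "i \<noteq> j"
  using that prime inj by (auto simp: inj_on_def intro!: primes_coprime)

lemma cong_prod:
  assumes "A \<subseteq> {..<r}" and "\<And>i. i \<in> A \<Longrightarrow> [x = y] (mod p i)"
  shows "[x = y] (mod (\<Prod>i\<in>A. p i))"
  using assms coprime by (intro cong_cong_prod_coprime_nat) blast+

lemma n_div: "n div p i = N * (\<Prod>j\<in>{..<r} - {i}. p j)" and p_dvd_n: "p i dvd n" if "i < r"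
proof -
  have "n = p i * (N * (\<Prod>j\<in>{..<r} - {i}. p j))"
    using that by (simp add: n_eq prod.remove[of "{..<r}" i])
  then show "n div p i = N * (\<Prod>j\<in>{..<r} - {i}. p j)" "p i dvd n"
    using prime_gt_0_nat[OF prime[OF that]] by simp_all
qed

text \<open>The shift is \<open>N\<close> times the product of the other primes: it vanishes modulo
  \<open>N\<close> and changes the quotient by a multiple of every \<open>p j\<close> with
  \<open>j \<noteq> i\<close>.\<close>

lemma facet_shift:
  assumes "i < r"
  shows "(k + n div p i) mod N = k mod N" and "ridge i ((k + n div p i) div N) = ridge i (k div N)"
proof -
  let ?q = "\<Prod>j\<in>{..<r} - {i}. p j"
  show "(k + n div p i) mod N = k mod N" by (simp add: n_div[OF assms])
  have "(k + n div p i) div N = k div N + ?q" using N_pos by (simp add: n_div[OF assms])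
  moreover have "[k div N + ?q = k div N + 0] (mod p j)" if "j \<in> {..<r} - {i}" for j
    using that by (intro cong_add) (auto simp: cong_0_iff dvd_prodI)
  ultimately show "ridge i ((k + n div p i) div N) = ridge i (k div N)"
    by (simp add: join_face_eq_iff)
qed

text \<open>The coboundary, placed in copy \<open>a\<close> and zero on the others, is a sum of
  parts \<open>g i\<close> that see only the face omitting \<open>i\<close>. Each part has period
  \<open>n div p i\<close>, so its sum against powers of \<zeta> vanishes.\<close>

lemma relation_of_functional:
  assumes \<phi>: "Vector_Spaces.linear chain_scale (*) \<phi>"
  shows "(\<Sum>k<n. of_rat (if k mod N = a then \<phi> (facet_boundary (facet (k div N))) else 0) * \<zeta> ^ k) = 0"
proof -
  define g where "g i k = (if k mod N = a
    then (- 1) ^ i * \<phi> (Poly_Mapping.single (ridge i (k div N)) 1) else 0)" for i k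
  have "(\<Sum>k<n. of_rat (g i k) * \<zeta> ^ k) = 0" if i: "i < r" for i
  proof (rule sum_periodic_roots_of_unity_eq_0[where d = "n div p i"])
    show "of_rat (g i (k + n div p i)) = (of_rat (g i k) :: complex)" for k
      by (simp add: g_def facet_shift[OF i])
    show "n div p i dvd n" using p_dvd_n[OF i] by (metis dvd_div_mult_self dvd_triv_left)
    have "n div p i < n" "n div p i > 0"
      using n_pos prime_gt_1_nat[OF prime[OF i]] p_dvd_n[OF i]
      by (auto simp: div_greater_zero_iff dvd_imp_le)
    then show "\<zeta> ^ (n div p i) \<noteq> 1"
      using prim by (simp add: primitive_root_of_unity_def)
  qed (rule \<zeta>_power_n)
  then have "(\<Sum>i<r. \<Sum>k<n. of_rat (g i k) * \<zeta> ^ k) = 0" by simp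
  moreover have "(if k mod N = a then \<phi> (facet_boundary (facet (k div N))) else 0) = (\<Sum>i<r. g i k)" for k
    by (simp add: g_def linear_boundary_join_face[OF \<phi>])
  ultimately show ?thesis
    by (subst (asm) sum.swap) (simp add: of_rat_sum sum_distrib_right)
qed

text \<open>The components of the periodic decomposition, restricted to the class of
  \<open>a\<close> modulo \<open>N\<close>, depend only on the face omitting \<open>i\<close>. With
  signs they form a cochain whose coboundary is \<open>c\<close> there.\<close>

lemma functional_of_relation:
  assumes per: "\<And>k. c (k + n) = c k" and rel: "(\<Sum>k<n. of_rat (c k) * \<zeta> ^ k) = 0"
  obtains \<phi> where "Vector_Spaces.linear chain_scale (*) \<phi>"
    and "\<And>x. \<phi> (facet_boundary (facet x)) = c (a + N * x)"
proof -
  have "p i > 0 \<and> p i dvd n" if "i \<in> {..<r}" for i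
    using that prime_gt_0_nat[OF prime] p_dvd_n by auto
  then obtain g where g: "\<And>i k. i \<in> {..<r} \<Longrightarrow> g i (k + n div p i) = g i k"
    and c: "\<And>k. c k = (\<Sum>i<r. g i k)"
    using vanishing_sum_of_roots_of_unity[OF prim finite_lessThan _ cover per rel] by metis
  have g_eq: "g i (a + N * x) = g i (a + N * y)" if i: "i < r" and eq: "ridge i x = ridge i y" for i x y
  proof -
    have "[x = y] (mod (\<Prod>j\<in>{..<r} - {i}. p j))"
      using eq by (intro cong_prod) (auto simp: join_face_eq_iff)
    then have "[N * x = N * y] (mod n div p i)"
      by (simp only: cong_def n_div[OF i] mult_mod_right[symmetric])
    then have "[a + N * x = a + N * y] (mod n div p i)"
      by (intro cong_add cong_refl)
    then show ?thesis
      using periodic_mod[of "g i" "n div p i", OF g] i unfolding cong_def by (metis lessThan_iff)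
  qed
  \<comment> \<open>A codimension one face determines \<open>i\<close>, and it determines
    \<open>x\<close> up to changes that \<open>g i\<close> ignores, so the choice is harmless. The
    sign cancels that of the boundary.\<close>
  define \<psi> where "\<psi> F = (let (i, x) = SOME (i, x). i < r \<and> F = ridge i x in (- 1) ^ i * g i (a + N * x))"
    for F
  have \<psi>: "\<psi> (ridge i x) = (- 1) ^ i * g i (a + N * x)" if i: "i < r" for i x
  proof -
    let ?P = "\<lambda>(j, y). j < r \<and> ridge i x = ridge j y"
    obtain j y where jy: "(SOME z. ?P z) = (j, y)" by fastforce
    have "?P (SOME z. ?P z)" by (rule someI[of ?P "(i, x)"]) (use i in simp)
    then have P: "j < r" "ridge i x = ridge j y" by (simp_all add: jy)
    then have "{..<r} - {i} = {..<r} - {j}" by (simp add: join_face_eq_iff)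
    then have "i = j" using i P(1) by blast
    moreover have "\<psi> (ridge i x) = (- 1) ^ j * g j (a + N * y)"
      by (simp only: \<psi>_def Let_def jy prod.case)
    ultimately show ?thesis using g_eq[OF i, of x y] P(2) by simp
  qed
  obtain \<phi> where \<phi>: "Vector_Spaces.linear chain_scale (*) \<phi>"
    "\<And>F. \<phi> (Poly_Mapping.single F 1) = \<psi> F"
    using chain_linear_functional[of \<psi>] by blast
  have "\<phi> (facet_boundary (facet x)) = c (a + N * x)" for x
    by (simp add: linear_boundary_join_face[OF \<phi>(1)] \<phi>(2) \<psi> c flip: mult.assoc power_mult_distrib)
  with \<phi>(1) show thesis by (rule that)
qed

lemma top_faces_eq: "top_faces (join_of_points r p) = facet ` {..<\<Prod>i<r. p i}"
  using prime_gt_0_nat[OF prime] coprime by (rule top_faces_join_of_points)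

text \<open>Division by \<open>N\<close> with remainder is bijective, and the Chinese remainder
  theorem identifies quotients below the product of the primes with facets.\<close>

lemma bij_betw_copy_facet: "bij_betw copy_facet {..<n} ({..<N} \<times> top_faces (join_of_points r p))"
proof (rule bij_betw_imageI)
  let ?q = "\<Prod>i<r. p i"
  have div: "k div N < ?q" if "k < n" for k
    using that N_pos by (simp add: n_eq div_less_iff_less_mult mult.commute)
  show "inj_on copy_facet {..<n}"
  proof (rule inj_onI)
    fix k l assume kl: "k \<in> {..<n}" "l \<in> {..<n}" "copy_facet k = copy_facet l"
    then have "[k div N = l div N] (mod ?q)"
      by (intro cong_prod) (auto simp: copy_facet_def join_face_eq_iff)
    then have "k div N = l div N"
      using div kl by (simp add: cong_def)
    moreover have "k mod N = l mod N" using kl(3) by (simp add: copy_facet_def)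
    ultimately show "k = l" by (metis div_mult_mod_eq)
  qed
  show "copy_facet ` {..<n} = {..<N} \<times> top_faces (join_of_points r p)"
  proof (intro equalityI subsetI)
    fix z assume "z \<in> copy_facet ` {..<n}"
    then show "z \<in> {..<N} \<times> top_faces (join_of_points r p)"
      using N_pos div by (auto simp: top_faces_eq copy_facet_def)
  next
    fix z assume "z \<in> {..<N} \<times> top_faces (join_of_points r p)"
    then obtain a x where z: "z = (a, facet x)" and a: "a < N" and x: "x < ?q"
      by (auto simp: top_faces_eq)
    have "copy_facet (a + N * x) = z" using a by (simp add: z copy_facet_def)
    moreover have "a + N * x < N * Suc x" using a by simp
    then have "a + N * x < n" using x N_pos unfolding n_eq
      by (meson Suc_leI less_le_trans mult_le_mono2)
    ultimately show "z \<in> copy_facet ` {..<n}" by blast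
  qed
qed

text \<open>Both sides forbid nonzero functions supported in \<open>A\<close>: relations on the
  left, coboundaries in one copy on the right. The two preceding translations between functionals
  and relations match them.\<close>

lemma mem_indeps_cyclotomic_matroid_iff_dual:
  assumes A: "A \<subseteq> {..<n}"
  shows "(\<lambda>k. \<zeta> ^ k) ` A \<in> indeps (cyclotomic_matroid n \<zeta>) \<longleftrightarrow>
    copy_facet ` A \<in> indeps (dual_matroid (direct_sum_matroid {..<N}
      (\<lambda>_. simplicial_matroid lex_less (join_of_points r p))))"
proof -
  interpret vector_space chain_scale by (rule vector_space_chain_scale)
  let ?T = "top_faces (join_of_points r p)"
  let ?slice = "\<lambda>a. {F. (a, F) \<in> copy_facet ` A}"
  have bij: "bij_betw copy_facet {..<n} ({..<N} \<times> ?T)" by (rule bij_betw_copy_facet)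
  have inj: "inj_on copy_facet {..<n}" by (rule bij_betw_imp_inj_on[OF bij])
  have image: "copy_facet ` {..<n} = {..<N} \<times> ?T" by (rule bij_betw_imp_surj_on[OF bij])
  have mem: "k \<in> A" if "copy_facet k \<in> copy_facet ` A" "k < n" for k
    using inj_on_image_mem_iff[OF inj _ A, of k] that by simp
  have in_T: "facet (k div N) \<in> ?T" if "k < n" for k
  proof -
    have "copy_facet k \<in> {..<N} \<times> ?T" using that by (simp flip: image)
    then show ?thesis by (simp add: copy_facet_def)
  qed
  have T_cases: "\<exists>k<n. copy_facet k = (a, F)" if "a \<in> {..<N}" "F \<in> ?T" for a F
  proof -
    have "(a, F) \<in> copy_facet ` {..<n}" using that by (simp add: image)
    then show ?thesis by auto
  qed
  have ground: "ground (simplicial_matroid lex_less (join_of_points r p)) = ?T"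
    by (simp add: simplicial_matroid_def represented_matroid_def)
  have sub: "copy_facet ` A \<subseteq> {..<N} \<times> ?T"
    using A by (simp add: image_mono flip: image)
  have finT: "finite ?T" by (simp add: top_faces_eq)
  have dual: "copy_facet ` A \<in> indeps (dual_matroid (direct_sum_matroid {..<N}
      (\<lambda>_. simplicial_matroid lex_less (join_of_points r p)))) \<longleftrightarrow>
    (\<forall>a\<in>{..<N}. \<forall>\<phi>. Vector_Spaces.linear chain_scale (*) \<phi> \<longrightarrow>
      (\<forall>F\<in>?T - ?slice a. \<phi> (facet_boundary F) = 0) \<longrightarrow> (\<forall>F\<in>?T. \<phi> (facet_boundary F) = 0))"
  proof -
    have "indeps (simplicial_matroid lex_less (join_of_points r p)) \<subseteq>
        Pow (ground (simplicial_matroid lex_less (join_of_points r p)))"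
      by (auto simp: simplicial_matroid_def represented_matroid_def)
    moreover have "?slice a \<subseteq> ?T" for a using sub by blast
    ultimately show ?thesis
      using sub
      by (simp add: mem_indeps_dual_direct_sum_matroid_iff ground)
        (simp add: simplicial_matroid_def mem_indeps_dual_represented_matroid_iff[OF finT])
  qed
  show ?thesis
    unfolding dual mem_indeps_cyclotomic_matroid_iff[OF prim A]
  proof (intro iffI allI impI ballI)
    fix a \<phi> F
    assume ind: "\<forall>c. (\<forall>k\<in>{..<n} - A. c k = 0) \<longrightarrow> (\<Sum>k<n. of_rat (c k) * \<zeta> ^ k) = 0 \<longrightarrow>
        (\<forall>k<n. c k = 0)"
      and a: "a \<in> {..<N}" and \<phi>: "Vector_Spaces.linear chain_scale (*) \<phi>"
        "\<forall>F\<in>?T - ?slice a. \<phi> (facet_boundary F) = 0" and F: "F \<in> ?T"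
    \<comment> \<open>The coboundary in copy \<open>a\<close> is extended by zero to the other
      copies.\<close>
    define c where "c k = (if k mod N = a then \<phi> (facet_boundary (facet (k div N))) else 0)" for k
    have "c k = 0" if k: "k \<in> {..<n} - A" for k
    proof (cases "k mod N = a")
      case True
      have "copy_facet k = (a, facet (k div N))" using True by (simp add: copy_facet_def)
      then have "facet (k div N) \<notin> ?slice a" using mem[of k] k by auto
      then have "\<phi> (facet_boundary (facet (k div N))) = 0" using \<phi>(2) in_T[of k] k by blast
      then show ?thesis by (simp add: c_def)
    qed (simp add: c_def)
    moreover have "(\<Sum>k<n. of_rat (c k) * \<zeta> ^ k) = 0"
      unfolding c_def by (rule relation_of_functional[OF \<phi>(1)])
    ultimately have c: "\<forall>k<n. c k = 0" using ind by blast
    obtain k where k: "k < n" "copy_facet k = (a, F)" using T_cases[OF a F] by blast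
    then have "c k = \<phi> (facet_boundary F)" by (simp add: c_def copy_facet_def)
    with c k(1) show "\<phi> (facet_boundary F) = 0" by simp
  next
    fix c :: "nat \<Rightarrow> rat" and k
    assume ind: "\<forall>a\<in>{..<N}. \<forall>\<phi>. Vector_Spaces.linear chain_scale (*) \<phi> \<longrightarrow>
        (\<forall>F\<in>?T - ?slice a. \<phi> (facet_boundary F) = 0) \<longrightarrow> (\<forall>F\<in>?T. \<phi> (facet_boundary F) = 0)"
      and c: "\<forall>k\<in>{..<n} - A. c k = 0" "(\<Sum>k<n. of_rat (c k) * \<zeta> ^ k) = 0" and k: "k < n"
    \<comment> \<open>Only the copy containing \<open>k\<close> is examined; a relation may be
      nonzero on several.\<close>
    define a where "a = k mod N"
    have a: "a \<in> {..<N}" using N_pos by (simp add: a_def)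
    \<comment> \<open>Values of \<open>c\<close> from \<open>n\<close> on are arbitrary, so it is
      replaced by its periodic extension.\<close>
    have "(\<Sum>k<n. of_rat (c (k mod n)) * \<zeta> ^ k) = (\<Sum>k<n. of_rat (c k) * \<zeta> ^ k)"
      by (intro sum.cong) simp_all
    also have "\<dots> = 0" by (rule c(2))
    finally obtain \<phi> where \<phi>: "Vector_Spaces.linear chain_scale (*) \<phi>"
      "\<And>x. \<phi> (facet_boundary (facet x)) = c ((a + N * x) mod n)"
      using functional_of_relation[of "\<lambda>k. c (k mod n)" a] by auto
    have val: "\<phi> (facet_boundary (facet (l div N))) = c l" if "l < n" "l mod N = a" for l
    proof -
      have "a + N * (l div N) = l" using that(2) by (metis mod_mult_div_eq)
      then show ?thesis using \<phi>(2) that(1) by simp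
    qed
    have "\<phi> (facet_boundary F) = 0" if F: "F \<in> ?T - ?slice a" for F
    proof -
      obtain l where l: "l < n" "copy_facet l = (a, F)" using T_cases[OF a] F by blast
      have "l \<notin> A"
      proof
        assume "l \<in> A"
        then have "(a, F) \<in> copy_facet ` A" by (simp flip: l(2))
        with F show False by simp
      qed
      then show ?thesis using val[of l] l c(1) by (simp add: copy_facet_def)
    qed
    then have "\<phi> (facet_boundary (facet (k div N))) = 0"
      using ind a \<phi>(1) in_T[OF k] by blast
    then show "c k = 0" using val[OF k] by (simp add: a_def)
  qed
qed

lemma matroid_iso_dual:
  "matroid_iso (cyclotomic_matroid n \<zeta>)
    (dual_matroid (direct_sum_matroid {..<N}
      (\<lambda>_. simplicial_matroid lex_less (join_of_points r p))))"
proof (rule matroid_isoI)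
  show "bij_betw (\<lambda>k. \<zeta> ^ k) {..<n} (ground (cyclotomic_matroid n \<zeta>))"
    using primitive_root_of_unity_inj_on[OF prim]
    by (simp add: cyclotomic_matroid_def represented_matroid_def bij_betw_def)
  show "bij_betw copy_facet {..<n} (ground (dual_matroid (direct_sum_matroid {..<N}
      (\<lambda>_. simplicial_matroid lex_less (join_of_points r p)))))"
    using bij_betw_copy_facet
    by (simp add: dual_matroid_def direct_sum_matroid_def simplicial_matroid_def
        represented_matroid_def)
qed (rule mem_indeps_cyclotomic_matroid_iff_dual)

end

theorem theorem1p1:
  fixes n r :: nat and p m :: "nat \<Rightarrow> nat" and \<zeta> :: complex
  assumes "\<And>i. i < r \<Longrightarrow> prime (p i)"
    and "inj_on p {..<r}"
    and "\<And>i. i < r \<Longrightarrow> m i > 0"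
    and "n = (\<Prod>i<r. p i ^ m i)"
    and "primitive_root_of_unity n \<zeta>"
  shows "matroid_iso (cyclotomic_matroid n \<zeta>)
           (dual_matroid
             (direct_sum_matroid {..<(\<Prod>i<r. p i ^ (m i - 1))}
               (\<lambda>_. simplicial_matroid lex_less (join_of_points r p))))"
proof -
  interpret cyclotomic_join r "\<Prod>i<r. p i ^ (m i - 1)" n p \<zeta>
  proof
    \<comment> \<open>Positivity of \<open>m i\<close> makes the truncated subtraction genuine, so
      one factor splits off each prime power.\<close>
    have "p i ^ m i = p i ^ (m i - 1) * p i" if "i < r" for i
      using assms(3)[OF that] by (metis power_minus_mult)
    then show "n = (\<Prod>i<r. p i ^ (m i - 1)) * (\<Prod>i<r. p i)"
      by (simp add: assms(4) flip: prod.distrib)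
    fix q :: nat assume q: "prime q" "q dvd n"
    then obtain i where i: "i < r" "q dvd p i ^ m i"
      unfolding assms(4) by (auto simp: prime_dvd_prod_iff)
    then have "q = p i"
      using q(1) assms(1) prime_dvd_power primes_dvd_imp_eq by blast
    with i(1) show "q \<in> p ` {..<r}" by blast
  qed (use assms in auto)
  show ?thesis by (rule matroid_iso_dual)
qed

end
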